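(* Let $M \subseteq \hat{\mathbb{R}}$ be a closed convex subset. The maximal subgroups of $M_2(\bar{\mathbb{R}})$ contained in the $\mathcal{D}$-class consisting of the matrices whose projective row space and projective column space are isometric to $M$ are isomorphic to: (i) the trivial group, if $M = \emptyset$; (ii) the additive group $\mathbb{R}$ of real numbers, if $M$ is a point, or an interval with precisely one real endpoint; (iii) the direct product $\mathbb{R} \times S_2$, if $M$ is an interval with two real endpoints; (iv) the wreath product $\mathbb{R} \wr S_2$, if $M = \hat{\mathbb{R}}$.
   Context: $\bar{\mathbb{R}} = \mathbb{R} \cup \{-\infty\}$ is the tropical semiring with $a \otimes b = a+b$ (with $-\infty$ absorbing) and $a \oplus b = \max\{a,b\}$. $M_2(\bar{\mathbb{R}})$ is the monoid of $2 \times 2$ matrices over $\bar{\mathbb{R}}$ under tropical matrix multiplication $(AB)_{ij} = \max_{k} (A_{ik} + B_{kj})$. A subgroup of this monoid is a subsemigroup which is a group (its identity may be any idempotent); a maximal subgroup is one maximal under inclusion. In a monoid $S$: $A \mathcal{R} B$ means $AS=BS$, $A \mathcal{L} B$ means $SA=SB$, and $\mathcal{D}$ is the smallest equivalence relation containing $\mathcal{L}$ and $\mathcal{R}$. The column space $C(A)$ (respectively row space $R(A)$) is the set of all tropical linear combinations in $\bar{\mathbb{R}}^2$ of the columns (respectively rows) of $A$. Let $\hat{\mathbb{R}} = \mathbb{R} \cup \{-\infty,\infty\}$ with the obvious order. Each non-zero vector $(a,b) \in \bar{\mathbb{R}}^2$ (i.e. $(a,b)\neq(-\infty,-\infty)$)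 is projected to the point of $\hat{\mathbb{R}}$ equal to $b-a$ if $a,b$ are real, $\infty$ if $a=-\infty$, and $-\infty$ if $b=-\infty$. The projective column space $PC(A)$ and projective row space $PR(A)$ are the images in $\hat{\mathbb{R}}$ under this projection of the non-zero vectors of $C(A)$ and $R(A)$ respectively. The closed convex subsets of $\hat{\mathbb{R}}$ are the empty set, the singletons (points), and the closed intervals $[x,y]$ with $x<y$ in $\hat{\mathbb{R}}$ (so "interval" means one with distinct endpoints). The distance $\delta$ on $\hat{\mathbb{R}}$ is $\delta(x,y) = |y-x|$ if $x,y \in \mathbb{R}$; $\delta(x,y)=0$ if $x=y=-\infty$ or $x=y=\infty$; and $\delta(x,y)=\infty$ otherwise. Two subsets of $\hat{\mathbb{R}}$ are isometric if there is a $\delta$-preserving bijection between them. $S_2$ is the symmetric group on two points, and $\mathbb{R} \wr S_2 = (\mathbb{R}\times\mathbb{R})\rtimes S_2$ with $S_2$ swapping the two factors. *)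

theory Defs
  imports
    "HOL-Analysis.Finite_Cartesian_Product"
    "HOL-Library.Extended_Real"
    "HOL-Algebra.Coset"
    "HOL-Algebra.Elementary_Groups"
    "HOL-Algebra.Sym_Groups"
begin

section \<open>The tropical semiring and tropical matrices\<close>

text \<open>The ring operations of the type classes are the tropical ones: \<open>+\<close> is the maximum,
  \<open>*\<close> is ordinary addition, \<open>0\<close> is minus infinity and \<open>1\<close> is the real number zero.
  Hence the library's \<open>**\<close> on \<open>tropical^2^2\<close> is the max-plus matrix product.\<close>

datatype tropical = MInf | Fin real

instantiation tropical :: comm_semiring_1
begin

definition zero_tropical :: tropical where "0 = MInf"

definition one_tropical :: tropical where "1 = Fin 0"

fun plus_tropical :: "tropical \<Rightarrow> tropical \<Rightarrow> tropical" where
  "MInf + y = y"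
| "x + MInf = x"
| "Fin a + Fin b = Fin (max a b)"

fun times_tropical :: "tropical \<Rightarrow> tropical \<Rightarrow> tropical" where
  "MInf * y = MInf"
| "x * MInf = MInf"
| "Fin a * Fin b = Fin (a + b)"

instance
proof
  fix a b c :: tropical
  show "a + b + c = a + (b + c)" by (cases a; cases b; cases c) (auto simp: max.assoc)
  show "a + b = b + a" by (cases a; cases b) (auto simp: max.commute)
  show "0 + a = a" by (simp add: zero_tropical_def)
  show "a * b * c = a * (b * c)" by (cases a; cases b; cases c) auto
  show "a * b = b * a" by (cases a; cases b) auto
  show "1 * a = a" by (cases a) (auto simp: one_tropical_def)
  show "(a + b) * c = a * c + b * c"
    by (cases a; cases b; cases c) (auto simp: max_add_distrib_left)
  show "0 * a = 0" by (simp add: zero_tropical_def)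
  show "a * 0 = 0" by (cases a) (auto simp: zero_tropical_def)
  show "(0::tropical) \<noteq> 1" by (simp add: zero_tropical_def one_tropical_def)
qed

end

definition trop_matrix_monoid :: "(tropical^2^2) monoid" where
  "trop_matrix_monoid = \<lparr>carrier = UNIV, monoid.mult = (**), one = mat 1\<rparr>"


section \<open>Green's relations and maximal subgroups of a monoid\<close>

definition green_R :: "('a, 'b) monoid_scheme \<Rightarrow> ('a \<times> 'a) set" where
  "green_R S = {(a, b). a \<in> carrier S \<and> b \<in> carrier S \<and>
     a <#\<^bsub>S\<^esub> carrier S = b <#\<^bsub>S\<^esub> carrier S}"

definition green_L :: "('a, 'b) monoid_scheme \<Rightarrow> ('a \<times> 'a) set" where
  "green_L S = {(a, b). a \<in> carrier S \<and> b \<in> carrier S \<and>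
     carrier S #>\<^bsub>S\<^esub> a = carrier S #>\<^bsub>S\<^esub> b}"

definition green_D :: "('a, 'b) monoid_scheme \<Rightarrow> ('a \<times> 'a) set" where
  "green_D S = \<Inter>{r. equiv (carrier S) r \<and> green_L S \<subseteq> r \<and> green_R S \<subseteq> r}"

text \<open>In contrast to the library's \<open>submonoid\<close> and \<open>subgroup\<close>, the identity \<open>e\<close> of a subgroup
  \<open>H\<close> of a monoid need not be the identity of the monoid.\<close>

definition sub_monoid_struct ::
    "('a, 'b) monoid_scheme \<Rightarrow> 'a \<Rightarrow> 'a set \<Rightarrow> ('a, 'b) monoid_scheme" where
  "sub_monoid_struct S e H = S\<lparr>carrier := H, one := e\<rparr>"

definition is_subgroup :: "('a, 'b) monoid_scheme \<Rightarrow> 'a \<Rightarrow> 'a set \<Rightarrow> bool" where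
  "is_subgroup S e H \<longleftrightarrow> H \<subseteq> carrier S \<and> group (sub_monoid_struct S e H)"

definition is_maximal_subgroup :: "('a, 'b) monoid_scheme \<Rightarrow> 'a \<Rightarrow> 'a set \<Rightarrow> bool" where
  "is_maximal_subgroup S e H \<longleftrightarrow>
     is_subgroup S e H \<and> (\<forall>f K. is_subgroup S f K \<and> H \<subseteq> K \<longrightarrow> K = H)"


section \<open>Projective row and column spaces\<close>

definition column_space :: "tropical^2^2 \<Rightarrow> (tropical^2) set" where
  "column_space A = {\<Sum>j\<in>UNIV. c j *s column j A | c. True}"

definition row_space :: "tropical^2^2 \<Rightarrow> (tropical^2) set" where
  "row_space A = {\<Sum>i\<in>UNIV. c i *s row i A | c. True}"

text \<open>The first equation is only relevant for a real second component: the projection is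
  applied to non-zero vectors only, \<open>0\<close> being the vector with both components \<open>MInf\<close>.\<close>

fun proj_coords :: "tropical \<Rightarrow> tropical \<Rightarrow> ereal" where
  "proj_coords MInf b = \<infinity>"
| "proj_coords (Fin a) MInf = -\<infinity>"
| "proj_coords (Fin a) (Fin b) = ereal (b - a)"

definition proj :: "tropical^2 \<Rightarrow> ereal" where
  "proj v = proj_coords (v $ 1) (v $ 2)"

definition proj_column_space :: "tropical^2^2 \<Rightarrow> ereal set" where
  "proj_column_space A = proj ` (column_space A - {0})"

definition proj_row_space :: "tropical^2^2 \<Rightarrow> ereal set" where
  "proj_row_space A = proj ` (row_space A - {0})"


section \<open>Closed convex sets and isometry\<close>

definition closed_convex :: "ereal set \<Rightarrow> bool" where
  "closed_convex M \<longleftrightarrow> M = {} \<or> (\<exists>x. M = {x}) \<or> (\<exists>x y. x < y \<and> M = {x..y})"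

definition \<delta> :: "ereal \<Rightarrow> ereal \<Rightarrow> ereal" where
  "\<delta> x y = (if \<bar>x\<bar> \<noteq> \<infinity> \<and> \<bar>y\<bar> \<noteq> \<infinity> then \<bar>y - x\<bar> else if x = y then 0 else \<infinity>)"

definition isometric :: "ereal set \<Rightarrow> ereal set \<Rightarrow> bool" where
  "isometric X Y \<longleftrightarrow>
     (\<exists>f. bij_betw f X Y \<and> (\<forall>x\<in>X. \<forall>y\<in>X. \<delta> (f x) (f y) = \<delta> x y))"

definition isometry_class :: "ereal set \<Rightarrow> (tropical^2^2) set" where
  "isometry_class M = {A. isometric (proj_row_space A) M \<and> isometric (proj_column_space A) M}"


section \<open>The groups in the classification\<close>

definition real_add_group :: "real monoid" where
  "real_add_group = \<lparr>carrier = UNIV, monoid.mult = (+), one = 0\<rparr>"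

definition semidirect_product ::
    "('a, 'c) monoid_scheme \<Rightarrow> ('b, 'd) monoid_scheme \<Rightarrow> ('b \<Rightarrow> 'a \<Rightarrow> 'a) \<Rightarrow> ('a \<times> 'b) monoid" where
  "semidirect_product N K \<phi> =
     \<lparr>carrier = carrier N \<times> carrier K,
      monoid.mult = (\<lambda>(n, k) (n', k'). (n \<otimes>\<^bsub>N\<^esub> \<phi> k n', k \<otimes>\<^bsub>K\<^esub> k')),
      one = (\<one>\<^bsub>N\<^esub>, \<one>\<^bsub>K\<^esub>)\<rparr>"

text \<open>\<open>sym_group 2\<close> consists of the permutations of \<open>{1, 2}\<close>; the non-identity element swaps
  the two factors.\<close>

definition swap_action :: "(nat \<Rightarrow> nat) \<Rightarrow> 'a \<times> 'a \<Rightarrow> 'a \<times> 'a" where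
  "swap_action \<sigma> x = (if \<sigma> = id then x else prod.swap x)"

definition wreath_S2 :: "('a, 'c) monoid_scheme \<Rightarrow> (('a \<times> 'a) \<times> (nat \<Rightarrow> nat)) monoid" where
  "wreath_S2 G = semidirect_product (G \<times>\<times> G) (sym_group 2) swap_action"

end

theory Submission
  imports Defs "HOL-Analysis.Cartesian_Space"
begin

text \<open>The idea is to work with matrices only up to multiplication by invertible matrices, which are
here permutation matrices with real entries in place of the ones. If the two terms \<open>p * s\<close> and
\<open>q * r\<close> of the tropical determinant agree, the matrix is zero or an outer product of two non-zero
vectors (\<open>singular_imp_outer\<close>). Otherwise one of the two terms dominates; after a row swap this is
the diagonal one, and scaling the rows gives an \<open>interval_matrix a b\<close>, with \<open>1\<close> on the diagonal,
off-diagonal entries \<open>a\<close> and \<open>b\<close> and \<open>a + b < 0\<close> in ordinary notation. Its column space is its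
set of fixed vectors, so that the projective column space is the interval \<open>[b, -a]\<close>, and its
projective row space is the mirror image \<open>[a, -b]\<close>.

Hence row and column spaces always have isometric projections. Green's relation R preserves the
column space and L preserves the row space, so the isometry type is an invariant of D. It is a
complete one (\<open>trop_D_iff_isometric\<close>): the isometry type of an interval is determined by its length
together with the property of having two infinite endpoints, and interval matrices with equal
data are conjugate, by a diagonal matrix translating the interval and possibly by the swap
reflecting it.

In any monoid the maximal subgroups are the groups of local units of idempotents, that is, the
unit groups of the monoids \<open>e S e\<close>. The idempotents are the zero matrix, the outer products
\<open>u v\<close> whose pairing \<open>v \<cdot> u\<close> is \<open>1\<close>, and the interval matrices themselves. For zero the local
units are trivial; for an outer product they are its real multiples. A local unit of an interval
matrix permutes the two endpoints of \<open>[b, -a]\<close>, so it is diagonal or antidiagonal times the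
idempotent (\<open>local_units_interval_matrix\<close>), and each finite entry among \<open>a\<close>, \<open>b\<close> is a linear
condition on the two scaling factors. With both entries infinite the factors are independent and
the swap exchanges them, which is the wreath product. With one finite entry the factors agree and
the ends cannot be exchanged. With two finite entries the factors agree up to a fixed offset, and
the reflection of the interval at its midpoint is an involution commuting with the scalars.\<close>

section \<open>Green's relations and maximal subgroups of a monoid\<close>

text \<open>Equality of principal right ideals amounts to mutual divisibility, since the identity puts each
  generator into its own ideal. The same holds on the left.\<close>

lemma (in monoid) green_R_iff:
  "(a, b) \<in> green_R G \<longleftrightarrow> a \<in> carrier G \<and> b \<in> carrier G \<and>
     (\<exists>x\<in>carrier G. a = b \<otimes> x) \<and> (\<exists>y\<in>carrier G. b = a \<otimes> y)"
proof (cases "a \<in> carrier G \<and> b \<in> carrier G")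
  case True
  have sub: "c <# carrier G \<subseteq> d <# carrier G \<longleftrightarrow> (\<exists>x\<in>carrier G. c = d \<otimes> x)"
    if cd: "c \<in> carrier G" "d \<in> carrier G" for c d
  proof
    assume "c <# carrier G \<subseteq> d <# carrier G"
    moreover have "c \<in> c <# carrier G"
      unfolding l_coset_def using cd by (auto intro!: bexI[of _ \<one>])
    ultimately show "\<exists>x\<in>carrier G. c = d \<otimes> x"
      unfolding l_coset_def by blast
  next
    assume "\<exists>x\<in>carrier G. c = d \<otimes> x"
    then obtain x where x: "x \<in> carrier G" "c = d \<otimes> x" by blast
    have "c \<otimes> y = d \<otimes> (x \<otimes> y)" if "y \<in> carrier G" for y
      using m_assoc[OF cd(2) x(1) that] x(2) by simp
    moreover have "x \<otimes> y \<in> carrier G" if "y \<in> carrier G" for y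
      using x(1) that by (rule m_closed)
    ultimately show "c <# carrier G \<subseteq> d <# carrier G"
      unfolding l_coset_def by (intro subsetI) (clarsimp, metis)
  qed
  show ?thesis
    using True sub[of a b] sub[of b a]
    unfolding green_R_def mem_Collect_eq case_prod_conv set_eq_subset by satx
qed (auto simp: green_R_def)

lemma (in monoid) green_L_iff:
  "(a, b) \<in> green_L G \<longleftrightarrow> a \<in> carrier G \<and> b \<in> carrier G \<and>
     (\<exists>x\<in>carrier G. a = x \<otimes> b) \<and> (\<exists>y\<in>carrier G. b = y \<otimes> a)"
proof (cases "a \<in> carrier G \<and> b \<in> carrier G")
  case True
  have sub: "carrier G #> c \<subseteq> carrier G #> d \<longleftrightarrow> (\<exists>x\<in>carrier G. c = x \<otimes> d)"
    if cd: "c \<in> carrier G" "d \<in> carrier G" for c d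
  proof
    assume "carrier G #> c \<subseteq> carrier G #> d"
    moreover have "c \<in> carrier G #> c"
      unfolding r_coset_def using cd by (auto intro!: bexI[of _ \<one>])
    ultimately show "\<exists>x\<in>carrier G. c = x \<otimes> d"
      unfolding r_coset_def by blast
  next
    assume "\<exists>x\<in>carrier G. c = x \<otimes> d"
    then obtain x where x: "x \<in> carrier G" "c = x \<otimes> d" by blast
    have "y \<otimes> c = (y \<otimes> x) \<otimes> d" if "y \<in> carrier G" for y
      using m_assoc[OF that x(1) cd(2)] x(2) by simp
    moreover have "y \<otimes> x \<in> carrier G" if "y \<in> carrier G" for y
      using that x(1) by (rule m_closed)
    ultimately show "carrier G #> c \<subseteq> carrier G #> d"
      unfolding r_coset_def by (intro subsetI) (clarsimp, metis)
  qed
  show ?thesis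
    using True sub[of a b] sub[of b a]
    unfolding green_L_def mem_Collect_eq case_prod_conv set_eq_subset by satx
qed (auto simp: green_L_def)

text \<open>An intersection of equivalence relations is one; the family is non-empty because the total
  relation on the carrier belongs to it.\<close>

lemma green_D_equiv: "equiv (carrier S) (green_D S)"
proof (rule equivI)
  have "equiv (carrier S) (carrier S \<times> carrier S)"
    by (auto simp: equiv_def refl_on_def sym_def trans_def)
  moreover have "green_L S \<subseteq> carrier S \<times> carrier S" "green_R S \<subseteq> carrier S \<times> carrier S"
    by (auto simp: green_L_def green_R_def)
  ultimately show "green_D S \<subseteq> carrier S \<times> carrier S"
    unfolding green_D_def by (intro Inter_lower) simp
  show "refl_on (carrier S) (green_D S)"
    unfolding green_D_def equiv_def refl_on_def by simp
  show "sym (green_D S)"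
  proof (rule symI)
    fix a b assume ab: "(a, b) \<in> green_D S"
    have "(b, a) \<in> r" if r: "equiv (carrier S) r" "green_L S \<subseteq> r" "green_R S \<subseteq> r" for r
      using ab r symD[of r a b] unfolding green_D_def equiv_def by simp
    then show "(b, a) \<in> green_D S" unfolding green_D_def by simp
  qed
  show "trans (green_D S)"
  proof (rule transI)
    fix a b c assume ab: "(a, b) \<in> green_D S" and bc: "(b, c) \<in> green_D S"
    have "(a, c) \<in> r" if r: "equiv (carrier S) r" "green_L S \<subseteq> r" "green_R S \<subseteq> r" for r
      using ab bc r transD[of r a b c] unfolding green_D_def equiv_def by simp
    then show "(a, c) \<in> green_D S" unfolding green_D_def by simp
  qed
qed

lemma green_D_least:
  assumes "equiv (carrier S) r" "green_L S \<subseteq> r" "green_R S \<subseteq> r"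
  shows "green_D S \<subseteq> r"
  using assms unfolding green_D_def by (intro Inter_lower) simp

lemma green_L_subset_D: "green_L S \<subseteq> green_D S"
  and green_R_subset_D: "green_R S \<subseteq> green_D S"
  unfolding green_D_def by (auto intro!: Inter_greatest)

text \<open>This is the unit group of the local monoid \<open>e S e\<close>: the fixed point equations say that the
  elements and their inverses lie in \<open>e S e\<close>. When \<open>e\<close> is idempotent it is the H-class of \<open>e\<close>.\<close>

definition local_units :: "('a, 'b) monoid_scheme \<Rightarrow> 'a \<Rightarrow> 'a set" where
  "local_units S e = {x \<in> carrier S. e \<otimes>\<^bsub>S\<^esub> x = x \<and> x \<otimes>\<^bsub>S\<^esub> e = x \<and>
     (\<exists>y\<in>carrier S. e \<otimes>\<^bsub>S\<^esub> y = y \<and> y \<otimes>\<^bsub>S\<^esub> e = y \<and> x \<otimes>\<^bsub>S\<^esub> y = e \<and> y \<otimes>\<^bsub>S\<^esub> x = e)}"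

lemma sub_monoid_struct_simps [simp]:
  "carrier (sub_monoid_struct S e H) = H"
  "monoid.mult (sub_monoid_struct S e H) = monoid.mult S"
  "one (sub_monoid_struct S e H) = e"
  by (simp_all add: sub_monoid_struct_def)

lemma subgroup_identity:
  assumes "is_subgroup S e H"
  shows "e \<in> H" "e \<in> carrier S" "e \<otimes>\<^bsub>S\<^esub> e = e"
proof -
  interpret g: group "sub_monoid_struct S e H"
    using assms by (simp add: is_subgroup_def)
  show "e \<in> H" using g.one_closed by simp
  then show "e \<in> carrier S" using assms by (auto simp: is_subgroup_def)
  show "e \<otimes>\<^bsub>S\<^esub> e = e" using g.l_one[OF g.one_closed] by simp
qed

lemma subgroup_subset_local_units:
  assumes "is_subgroup S e H"
  shows "H \<subseteq> local_units S e"
proof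
  fix x assume x: "x \<in> H"
  interpret g: group "sub_monoid_struct S e H"
    using assms by (simp add: is_subgroup_def)
  have HS: "H \<subseteq> carrier S" using assms by (simp add: is_subgroup_def)
  obtain y where y: "y \<in> H" "y \<otimes>\<^bsub>S\<^esub> x = e" "x \<otimes>\<^bsub>S\<^esub> y = e"
    using g.inv_closed g.l_inv g.r_inv x by (metis sub_monoid_struct_simps)
  show "x \<in> local_units S e"
    unfolding local_units_def
    using x y HS g.l_one[of x] g.r_one[of x] g.l_one[of y] g.r_one[of y]
    unfolding sub_monoid_struct_simps by blast
qed

lemma (in monoid) local_units_subgroup:
  assumes e: "e \<in> carrier G" "e \<otimes> e = e"
  shows "is_subgroup G e (local_units G e)"
  unfolding is_subgroup_def
proof
  show "local_units G e \<subseteq> carrier G" by (auto simp: local_units_def)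
  show "group (sub_monoid_struct G e (local_units G e))"
  proof (rule groupI, goal_cases)
    case (1 x y)
    then obtain x' y' where
      "x \<in> carrier G" "e \<otimes> x = x" "x \<otimes> e = x" "y \<in> carrier G" "e \<otimes> y = y" "y \<otimes> e = y"
      "x' \<in> carrier G" "e \<otimes> x' = x'" "x' \<otimes> e = x'" "x \<otimes> x' = e" "x' \<otimes> x = e"
      "y' \<in> carrier G" "e \<otimes> y' = y'" "y' \<otimes> e = y'" "y \<otimes> y' = e" "y' \<otimes> y = e"
      unfolding local_units_def sub_monoid_struct_simps by blast
    note h = this
    have "(x \<otimes> y) \<otimes> (y' \<otimes> x') = x \<otimes> (y \<otimes> y') \<otimes> x'"
      by (simp only: m_assoc m_closed h(1,4,7,12))
    then have a: "(x \<otimes> y) \<otimes> (y' \<otimes> x') = e" by (simp only: h)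
    have "(y' \<otimes> x') \<otimes> (x \<otimes> y) = y' \<otimes> (x' \<otimes> x) \<otimes> y"
      by (simp only: m_assoc m_closed h(1,4,7,12))
    then have b: "(y' \<otimes> x') \<otimes> (x \<otimes> y) = e" by (simp only: h)
    have c: "e \<otimes> (x \<otimes> y) = x \<otimes> y" "e \<otimes> (y' \<otimes> x') = y' \<otimes> x'"
      by (simp_all only: m_assoc[symmetric] h e m_closed)
    have d: "(x \<otimes> y) \<otimes> e = x \<otimes> y" "(y' \<otimes> x') \<otimes> e = y' \<otimes> x'"
      by (simp_all only: m_assoc h e m_closed)
    show ?case
      unfolding local_units_def sub_monoid_struct_simps
      by (intro CollectI conjI bexI[of _ "y' \<otimes> x'"]) (fact a b c d m_closed[OF h(1,4)] m_closed[OF h(12,7)])+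
  next
    case 2
    show ?case unfolding local_units_def sub_monoid_struct_simps using e by blast
  next
    case (3 x y z)
    then show ?case
      unfolding local_units_def sub_monoid_struct_simps by (intro m_assoc) blast+
  next
    case (4 x)
    then show ?case unfolding local_units_def sub_monoid_struct_simps by blast
  next
    case (5 x)
    then show ?case unfolding local_units_def sub_monoid_struct_simps by blast
  qed
qed

text \<open>A larger subgroup contains \<open>e\<close>, and a group has only one idempotent, so its identity is again
  \<open>e\<close> and its elements are local units of \<open>e\<close>.\<close>

lemma (in monoid) local_units_maximal:
  assumes e: "e \<in> carrier G" "e \<otimes> e = e"
  shows "is_maximal_subgroup G e (local_units G e)"
  unfolding is_maximal_subgroup_def
proof (intro conjI allI impI)
  show U: "is_subgroup G e (local_units G e)"
    using local_units_subgroup[OF e] .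
  fix f K assume K: "is_subgroup G f K \<and> local_units G e \<subseteq> K"
  interpret g: group "sub_monoid_struct G f K"
    using K by (simp add: is_subgroup_def)
  have "e \<in> K" using subgroup_identity(1)[OF U] K by blast
  then have "e = f"
    using g.l_cancel_one[of e e, unfolded sub_monoid_struct_simps] e(2) by blast
  then show "K = local_units G e"
    using K subgroup_subset_local_units[of G f K] by blast
qed

lemma (in monoid) maximal_subgroup_eq_local_units:
  assumes "is_maximal_subgroup G e H"
  shows "e \<in> carrier G" "e \<otimes> e = e" "e \<in> H" "H = local_units G e"
proof -
  have H: "is_subgroup G e H" using assms by (simp add: is_maximal_subgroup_def)
  show e: "e \<in> carrier G" "e \<otimes> e = e" "e \<in> H" using subgroup_identity[OF H] by auto
  show "H = local_units G e"
    using assms subgroup_subset_local_units[OF H] local_units_subgroup[OF e(1,2)]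
    unfolding is_maximal_subgroup_def by metis
qed

lemma (in monoid) local_units_green_R:
  assumes "e \<in> carrier G" "x \<in> local_units G e"
  shows "(e, x) \<in> green_R G"
proof -
  obtain y where "x \<in> carrier G" "y \<in> carrier G" "x \<otimes> y = e" "e \<otimes> x = x"
    using assms(2) unfolding local_units_def by blast
  then show ?thesis
    using assms(1) unfolding green_R_iff by (intro conjI bexI[of _ y] bexI[of _ x]) simp_all
qed

text \<open>An injective homomorphism from a group that sends the identity to \<open>e\<close> automatically lands in the
  local units of \<open>e\<close>, so only the surjectivity has to be checked when such a subgroup is
  identified with a concrete group.\<close>

lemma (in monoid) maximal_subgroup_iso:
  assumes H: "is_maximal_subgroup G e H" and K: "group K"
    and cl: "\<And>x. x \<in> carrier K \<Longrightarrow> f x \<in> carrier G"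
    and mult: "\<And>x y. x \<in> carrier K \<Longrightarrow> y \<in> carrier K \<Longrightarrow> f (x \<otimes>\<^bsub>K\<^esub> y) = f x \<otimes> f y"
    and one: "f \<one>\<^bsub>K\<^esub> = e"
    and inj: "inj_on f (carrier K)"
    and surj: "local_units G e \<subseteq> f ` carrier K"
  shows "sub_monoid_struct G e H \<cong> K"
proof -
  interpret K: group K by fact
  have "f x \<in> local_units G e" if x: "x \<in> carrier K" for x
  proof -
    have "e \<otimes> f y = f y" "f y \<otimes> e = f y" if "y \<in> carrier K" for y
      using mult[OF K.one_closed that] mult[OF that K.one_closed]
      unfolding K.l_one[OF that] K.r_one[OF that] one by metis+
    moreover have "f x \<otimes> f (inv\<^bsub>K\<^esub> x) = e" "f (inv\<^bsub>K\<^esub> x) \<otimes> f x = e"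
      using mult[OF x K.inv_closed[OF x]] mult[OF K.inv_closed[OF x] x]
      unfolding K.l_inv[OF x] K.r_inv[OF x] one by metis+
    ultimately show ?thesis
      unfolding local_units_def using cl x K.inv_closed[OF x] by blast
  qed
  then have img: "f ` carrier K = H"
    unfolding maximal_subgroup_eq_local_units(4)[OF H] using surj by blast
  have "f \<in> iso K (sub_monoid_struct G e H)"
    using img inj mult by (auto simp: iso_iff hom_def)
  then have "K \<cong> sub_monoid_struct G e H" by (rule is_isoI)
  then show ?thesis by (rule K.iso_sym)
qed

section \<open>Matrices given by their entries\<close>

declare zero_tropical_def [simp] one_tropical_def [simp]

definition mat2 :: "tropical \<Rightarrow> tropical \<Rightarrow> tropical \<Rightarrow> tropical \<Rightarrow> tropical^2^2" where
  "mat2 p q r s = vector [vector [p, q], vector [r, s]]"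

lemma mat2_nth [simp]:
  "mat2 p q r s $ 1 $ 1 = p" "mat2 p q r s $ 1 $ 2 = q"
  "mat2 p q r s $ 2 $ 1 = r" "mat2 p q r s $ 2 $ 2 = s"
  by (simp_all add: mat2_def)

lemma mat2_eq_iff [simp]:
  "mat2 p q r s = mat2 p' q' r' s' \<longleftrightarrow> p = p' \<and> q = q' \<and> r = r' \<and> s = s'"
  by (auto simp: vec_eq_iff forall_2)

lemma mat2_cases [cases type]:
  obtains p q r s where "A = mat2 p q r s"
proof
  show "A = mat2 (A$1$1) (A$1$2) (A$2$1) (A$2$2)"
    by (simp add: vec_eq_iff forall_2)
qed

lemma mat2_mult [simp]:
  "mat2 p q r s ** mat2 p' q' r' s' =
   mat2 (p * p' + q * r') (p * q' + q * s') (r * p' + s * r') (r * q' + s * s')"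
  by (simp add: vec_eq_iff forall_2 matrix_matrix_mult_def sum_2 del: zero_tropical_def)

lemma mat_1_eq_mat2: "mat 1 = mat2 1 0 0 1"
  by (simp add: vec_eq_iff forall_2 mat_def)

lemma transpose_mat2 [simp]:
  "Finite_Cartesian_Product.transpose (mat2 p q r s) = mat2 p r q s"
  by (simp add: vec_eq_iff forall_2 Finite_Cartesian_Product.transpose_def)

interpretation trop: monoid trop_matrix_monoid
  rewrites "carrier trop_matrix_monoid = UNIV"
    and "monoid.mult trop_matrix_monoid = (**)"
    and "one trop_matrix_monoid = mat 1"
proof -
  show "monoid trop_matrix_monoid"
    by unfold_locales (simp_all add: trop_matrix_monoid_def matrix_mul_assoc del: one_tropical_def)
qed (simp_all add: trop_matrix_monoid_def)

lemma vec2_eq_0_iff: "v = 0 \<longleftrightarrow> v $ 1 = 0 \<and> v $ 2 = (0 :: tropical)" for v :: "tropical^2"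
  by (simp add: vec_eq_iff forall_2 del: zero_tropical_def)

text \<open>The projective invariants become images of matrix multiplication, so that \<open>A ** B\<close> visibly has a
  smaller column space than \<open>A\<close>, and transposition turns row spaces into column spaces.\<close>

lemma column_space_eq_range: "column_space A = range (\<lambda>v. A *v v)"
proof -
  have "(\<Sum>j\<in>UNIV. c j *s column j A) = A *v (\<chi> j. c j)" for c
    by (simp add: vec_eq_iff matrix_vector_mult_def column_def mult.commute)
  moreover have "A *v v = (\<Sum>j\<in>UNIV. (v $ j) *s column j A)" for v
    by (simp add: vec_eq_iff matrix_vector_mult_def column_def mult.commute)
  ultimately show ?thesis
    unfolding column_space_def by fastforce
qed

lemma row_space_eq_column_space_transpose:
  "row_space A = column_space (Finite_Cartesian_Product.transpose A)"
  by (simp add: row_space_def column_space_def)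

lemma proj_row_space_eq:
  "proj_row_space A = proj_column_space (Finite_Cartesian_Product.transpose A)"
  by (simp add: proj_row_space_def proj_column_space_def row_space_eq_column_space_transpose)

lemma proj_column_space_mult_subset:
  "proj_column_space (A ** B) \<subseteq> proj_column_space A"
  by (auto simp: proj_column_space_def column_space_eq_range matrix_vector_mul_assoc[symmetric])

lemma mem_proj_column_space_mat2:
  "z \<in> proj_column_space (mat2 p q r s) \<longleftrightarrow>
   (\<exists>x y. z = proj_coords (p * x + q * y) (r * x + s * y) \<and>
          (p * x + q * y \<noteq> MInf \<or> r * x + s * y \<noteq> MInf))"
proof
  have nth: "(mat2 p q r s *v w) $ 1 = p * w$1 + q * w$2"
    "(mat2 p q r s *v w) $ 2 = r * w$1 + s * w$2" for w
    by (simp_all add: matrix_vector_mult_def sum_2 del: zero_tropical_def)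
  {
    assume "z \<in> proj_column_space (mat2 p q r s)"
    then obtain w where "z = proj (mat2 p q r s *v w)" "mat2 p q r s *v w \<noteq> 0"
      unfolding proj_column_space_def column_space_eq_range by blast
    then show "\<exists>x y. z = proj_coords (p * x + q * y) (r * x + s * y) \<and>
          (p * x + q * y \<noteq> MInf \<or> r * x + s * y \<noteq> MInf)"
      by (intro exI[of _ "w$1"] exI[of _ "w$2"]) (simp add: proj_def vec2_eq_0_iff nth)
  next
    assume "\<exists>x y. z = proj_coords (p * x + q * y) (r * x + s * y) \<and>
          (p * x + q * y \<noteq> MInf \<or> r * x + s * y \<noteq> MInf)"
    then obtain x y where z: "z = proj_coords (p * x + q * y) (r * x + s * y)"
      "p * x + q * y \<noteq> MInf \<or> r * x + s * y \<noteq> MInf" by blast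
    have "z = proj (mat2 p q r s *v vector [x, y])" "mat2 p q r s *v vector [x, y] \<noteq> 0"
      using z by (simp_all add: proj_def nth vec2_eq_0_iff)
    then show "z \<in> proj_column_space (mat2 p q r s)"
      unfolding proj_column_space_def column_space_eq_range by blast
  }
qed

section \<open>Projective column spaces of special matrices\<close>

fun ereal_of_tropical :: "tropical \<Rightarrow> ereal" where
  "ereal_of_tropical MInf = -\<infinity>"
| "ereal_of_tropical (Fin x) = ereal x"

definition interval_matrix :: "tropical \<Rightarrow> tropical \<Rightarrow> tropical^2^2" where
  "interval_matrix a b = mat2 1 a b 1"

definition outer :: "tropical \<Rightarrow> tropical \<Rightarrow> tropical \<Rightarrow> tropical \<Rightarrow> tropical^2^2" where
  "outer u u' v v' = mat2 (u * v) (u * v') (u' * v) (u' * v')"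

definition diag2 :: "real \<Rightarrow> real \<Rightarrow> tropical^2^2" where
  "diag2 \<alpha> \<beta> = mat2 (Fin \<alpha>) 0 0 (Fin \<beta>)"

definition swap2 :: "tropical^2^2" where
  "swap2 = mat2 0 1 1 0"

lemma tropical_mult_eq_MInf [simp]: "x * y = MInf \<longleftrightarrow> x = MInf \<or> y = MInf"
  by (cases x; cases y) auto

lemma tropical_add_eq_MInf [simp]: "x + y = MInf \<longleftrightarrow> x = MInf \<and> y = MInf"
  by (cases x; cases y) auto

lemma tropical_right [simp]: "x * MInf = MInf" "x + MInf = x" "Fin 0 * x = x" "x * Fin 0 = x"
  by (cases x; simp)+

lemma proj_coords_scale: "k \<noteq> MInf \<Longrightarrow> proj_coords (k * u) (k * v) = proj_coords u v"
  by (cases k; cases u; cases v) auto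

text \<open>All columns are multiples of the vector \<open>(u, u')\<close>, and a finite multiple does not move its
  projection.\<close>

lemma proj_column_space_outer:
  assumes "u \<noteq> MInf \<or> u' \<noteq> MInf" "v \<noteq> MInf \<or> v' \<noteq> MInf"
  shows "proj_column_space (outer u u' v v') = {proj_coords u u'}"
proof -
  have e: "proj_coords (u * v * x + u * v' * y) (u' * v * x + u' * v' * y) = proj_coords u u'"
    if "v * x + v' * y \<noteq> MInf" for x y
    using proj_coords_scale[OF that, of u u'] by (simp add: algebra_simps)
  show ?thesis
  proof (intro Set.set_eqI iffI)
    fix z assume "z \<in> proj_column_space (outer u u' v v')"
    then obtain x y where z: "z = proj_coords (u * v * x + u * v' * y) (u' * v * x + u' * v' * y)"
      "u * v * x + u * v' * y \<noteq> MInf \<or> u' * v * x + u' * v' * y \<noteq> MInf"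
      unfolding outer_def mem_proj_column_space_mat2 by blast
    then have "v * x + v' * y \<noteq> MInf" by auto
    from e[OF this] z show "z \<in> {proj_coords u u'}" by simp
  next
    fix z assume "z \<in> {proj_coords u u'}"
    moreover obtain x y where xy: "v * x + v' * y \<noteq> MInf"
      using assms(2) by (metis tropical_add_eq_MInf tropical_mult_eq_MInf tropical.distinct(1))
    moreover have "u * v * x + u * v' * y \<noteq> MInf \<or> u' * v * x + u' * v' * y \<noteq> MInf"
      using xy assms(1) by auto
    ultimately show "z \<in> proj_column_space (outer u u' v v')"
      using e[OF xy] unfolding outer_def mem_proj_column_space_mat2
      by (intro exI[of _ x] exI[of _ y]) simp
  qed
qed

lemma proj_column_space_zero: "proj_column_space (mat2 0 0 0 0) = {}"
  by (auto simp: mem_proj_column_space_mat2)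

text \<open>The hypothesis makes the matrix idempotent, so its column space consists of the vectors it fixes,
  namely those with \<open>b + v\<^sub>1 \<le> v\<^sub>2\<close> and \<open>a + v\<^sub>2 \<le> v\<^sub>1\<close> in ordinary notation. For the difference
  \<open>v\<^sub>2 - v\<^sub>1\<close> these are the two bounds \<open>b\<close> and \<open>- a\<close>.\<close>

lemma proj_column_space_interval_matrix:
  assumes "ereal_of_tropical b < - ereal_of_tropical a"
  shows "proj_column_space (interval_matrix a b) = {ereal_of_tropical b .. - ereal_of_tropical a}"
proof (intro Set.set_eqI iffI)
  fix z assume "z \<in> proj_column_space (interval_matrix a b)"
  then obtain x y where z: "z = proj_coords (x + a * y) (b * x + y)"
      "x + a * y \<noteq> MInf \<or> b * x + y \<noteq> MInf"
    unfolding interval_matrix_def mem_proj_column_space_mat2 by auto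
  then show "z \<in> {ereal_of_tropical b .. - ereal_of_tropical a}"
    using assms by (cases a; cases b; cases x; cases y) (auto simp: max_def)
next
  fix z assume z: "z \<in> {ereal_of_tropical b .. - ereal_of_tropical a}"
  have "\<exists>x y. z = proj_coords (x + a * y) (b * x + y) \<and> (x + a * y \<noteq> MInf \<or> b * x + y \<noteq> MInf)"
  proof (cases z)
    \<comment> \<open>the fixed vector \<open>(0, r)\<close> is its own image\<close>
    case (real r)
    show ?thesis
      using z real
      by (intro exI[of _ "Fin 0"] exI[of _ "Fin r"]; cases a; cases b) (auto simp: max_def)
  next
    case PInf
    then have "a = MInf" using z by (cases a) auto
    then show ?thesis using PInf
      by (intro exI[of _ "MInf"] exI[of _ "Fin 0"]) auto
  next
    case MInf
    then have "b = MInf" using z by (cases b) auto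
    then show ?thesis using MInf
      by (intro exI[of _ "Fin 0"] exI[of _ "MInf"]) auto
  qed
  then show "z \<in> proj_column_space (interval_matrix a b)"
    unfolding interval_matrix_def mem_proj_column_space_mat2 by simp
qed

text \<open>A coordinate transformation \<open>(f, g)\<close> of the plane that acts on projective points by \<open>h\<close> acts by \<open>h\<close>
  on projective column spaces. It is used for the scalings and for the exchange of coordinates.\<close>

lemma proj_column_space_image:
  assumes "\<And>u v. (f u v = MInf \<and> g u v = MInf) \<longleftrightarrow> (u = MInf \<and> v = MInf)"
    and "\<And>u v. u \<noteq> MInf \<or> v \<noteq> MInf \<Longrightarrow> proj_coords (f u v) (g u v) = h (proj_coords u v)"
    and "\<And>x y. f (p * x + q * y) (r * x + s * y) = p' * x + q' * y"
    and "\<And>x y. g (p * x + q * y) (r * x + s * y) = r' * x + s' * y"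
  shows "proj_column_space (mat2 p' q' r' s') = h ` proj_column_space (mat2 p q r s)"
proof (intro Set.set_eqI iffI)
  fix z assume "z \<in> proj_column_space (mat2 p' q' r' s')"
  then obtain x y where z: "z = proj_coords (p' * x + q' * y) (r' * x + s' * y)"
      "p' * x + q' * y \<noteq> MInf \<or> r' * x + s' * y \<noteq> MInf"
    unfolding mem_proj_column_space_mat2 by blast
  have nz: "p * x + q * y \<noteq> MInf \<or> r * x + s * y \<noteq> MInf"
    using z(2) assms(1)[of "p * x + q * y" "r * x + s * y"] unfolding assms(3,4) by blast
  have "z = h (proj_coords (p * x + q * y) (r * x + s * y))"
    using assms(2)[OF nz] unfolding assms(3,4) using z(1) by simp
  then show "z \<in> h ` proj_column_space (mat2 p q r s)"
    using nz mem_proj_column_space_mat2 by blast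
next
  fix z assume "z \<in> h ` proj_column_space (mat2 p q r s)"
  then obtain x y where z: "z = h (proj_coords (p * x + q * y) (r * x + s * y))"
      and nz: "p * x + q * y \<noteq> MInf \<or> r * x + s * y \<noteq> MInf"
    unfolding image_iff mem_proj_column_space_mat2 Bex_def by blast
  have "z = proj_coords (p' * x + q' * y) (r' * x + s' * y)"
    using assms(2)[OF nz] unfolding assms(3,4) using z(1) by simp
  moreover have "p' * x + q' * y \<noteq> MInf \<or> r' * x + s' * y \<noteq> MInf"
    using nz assms(1)[of "p * x + q * y" "r * x + s * y"] unfolding assms(3,4) by blast
  ultimately show "z \<in> proj_column_space (mat2 p' q' r' s')"
    unfolding mem_proj_column_space_mat2 by blast
qed

lemma proj_column_space_diag2:
  "proj_column_space (diag2 \<alpha> \<beta> ** A) = (\<lambda>x. x + ereal (\<beta> - \<alpha>)) ` proj_column_space A"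
proof (cases A)
  case (1 p q r s)
  have "proj_coords (Fin \<alpha> * u) (Fin \<beta> * v) = proj_coords u v + ereal (\<beta> - \<alpha>)"
    if "u \<noteq> MInf \<or> v \<noteq> MInf" for u v
    using that by (cases u; cases v) auto
  then show ?thesis
    unfolding 1 diag2_def mat2_mult
    by (intro proj_column_space_image[where f = "\<lambda>u v. Fin \<alpha> * u" and g = "\<lambda>u v. Fin \<beta> * v"])
       (auto simp: algebra_simps)
qed

lemma proj_column_space_swap2:
  "proj_column_space (swap2 ** A) = uminus ` proj_column_space A"
proof (cases A)
  case (1 p q r s)
  have "proj_coords v u = - proj_coords u v"
    if "u \<noteq> MInf \<or> v \<noteq> MInf" for u v
    using that by (cases u; cases v) auto
  then show ?thesis
    unfolding 1 swap2_def mat2_mult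
    by (intro proj_column_space_image[where f = "\<lambda>u v. v" and g = "\<lambda>u v. u"]) auto
qed

section \<open>Isometries of closed intervals\<close>

lemma isometric_refl: "isometric X X"
  unfolding isometric_def by (intro exI[of _ id]) auto

lemma isometric_sym: "isometric X Y \<Longrightarrow> isometric Y X"
proof -
  assume "isometric X Y"
  then obtain f where f: "bij_betw f X Y" "\<forall>x\<in>X. \<forall>y\<in>X. \<delta> (f x) (f y) = \<delta> x y"
    unfolding isometric_def by blast
  have "f (inv_into X f x) = x" "inv_into X f x \<in> X" if "x \<in> Y" for x
    using bij_betw_inv_into_right[OF f(1) that] bij_betw_apply[OF bij_betw_inv_into[OF f(1)] that]
    by auto
  then have "\<delta> (inv_into X f x) (inv_into X f y) = \<delta> x y" if "x \<in> Y" "y \<in> Y" for x y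
    using f(2) that by metis
  then show "isometric Y X"
    unfolding isometric_def using bij_betw_inv_into[OF f(1)] by blast
qed

lemma isometric_trans: "isometric X Y \<Longrightarrow> isometric Y Z \<Longrightarrow> isometric X Z"
proof -
  assume "isometric X Y" "isometric Y Z"
  then obtain f g where f: "bij_betw f X Y" "\<forall>x\<in>X. \<forall>y\<in>X. \<delta> (f x) (f y) = \<delta> x y"
    and g: "bij_betw g Y Z" "\<forall>x\<in>Y. \<forall>y\<in>Y. \<delta> (g x) (g y) = \<delta> x y"
    unfolding isometric_def by blast
  have "f x \<in> Y" if "x \<in> X" for x using f(1) that by (rule bij_betw_apply)
  then show "isometric X Z"
    unfolding isometric_def using bij_betw_trans[OF f(1) g(1)] f(2) g(2)
    by (intro exI[of _ "g \<circ> f"]) auto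
qed

lemma isometric_image:
  assumes "inj h" "\<And>x y. \<delta> (h x) (h y) = \<delta> x y"
  shows "isometric X (h ` X)"
  unfolding isometric_def using assms
  by (intro exI[of _ h]) (auto simp: bij_betw_def intro: inj_on_subset)

lemma isometric_uminus: "isometric X (uminus ` X)"
proof (rule isometric_image)
  show "\<delta> (- x) (- y) = \<delta> x y" for x y
    by (cases x; cases y) (auto simp: \<delta>_def)
qed (auto simp: inj_def)

lemma isometric_translate: "isometric X ((\<lambda>x. x + ereal t) ` X)"
proof (rule isometric_image)
  show "inj (\<lambda>x. x + ereal t)"
  proof (rule injI)
    fix x y assume "x + ereal t = y + ereal t"
    then show "x = y" by (cases x; cases y) auto
  qed
  show "\<delta> (x + ereal t) (y + ereal t) = \<delta> x y" for x y
    by (cases x; cases y) (auto simp: \<delta>_def)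
qed

lemma isometric_singletons: "isometric {x} {y}"
  unfolding isometric_def by (intro exI[of _ "\<lambda>_. y"]) (auto simp: \<delta>_def bij_betw_def zero_ereal_def)

lemma isometric_empty_iff: "isometric X {} \<longleftrightarrow> X = {}" "isometric {} X \<longleftrightarrow> X = {}"
  unfolding isometric_def bij_betw_def by auto

lemma isometric_singleton_cases:
  assumes "isometric X Y" "X = {x}"
  obtains y where "Y = {y}"
  using assms unfolding isometric_def bij_betw_def by auto

lemma Icc_not_singleton: "x < y \<Longrightarrow> {x..y} \<noteq> {z}" for x y z :: ereal
  by (metis atLeastatMost_empty_iff less_imp_le singletonD atLeastAtMost_iff order_refl less_irrefl)

text \<open>The ends of the first interval are at distance \<open>y - x\<close>, which is infinite as soon as one of them
  is, and no two points of the second interval are further apart than its length.\<close>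

lemma isometric_Icc_length_le:
  assumes "x < y" "isometric {x..y} {x'..y'}"
  shows "y - x \<le> y' - x'"
proof -
  obtain f where f: "bij_betw f {x..y} {x'..y'}"
      "\<forall>p\<in>{x..y}. \<forall>q\<in>{x..y}. \<delta> (f p) (f q) = \<delta> p q"
    using assms(2) unfolding isometric_def by blast
  have "f x \<in> {x'..y'}" "f y \<in> {x'..y'}"
    using bij_betw_apply[OF f(1), of x] bij_betw_apply[OF f(1), of y] assms(1) by auto
  moreover have "f x \<noteq> f y"
    using bij_betw_imp_inj_on[OF f(1)] assms(1) by (auto dest: inj_onD[of f _ x y])
  moreover have "\<delta> p q \<le> y' - x'" if "p \<in> {x'..y'}" "q \<in> {x'..y'}" "p \<noteq> q" for p q
    using that by (cases p; cases q; cases x'; cases y') (auto simp: \<delta>_def)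
  ultimately have "\<delta> (f x) (f y) \<le> y' - x'" by blast
  moreover have "\<delta> (f x) (f y) = \<delta> x y" using f(2) assms(1) by auto
  moreover have "\<delta> x y = y - x" using assms(1) by (cases x; cases y) (auto simp: \<delta>_def)
  ultimately show ?thesis by simp
qed

text \<open>Length does not separate the extended line from half-lines, as both have infinite length. The
  line, however, contains three points at pairwise infinite distance, and among three such points
  both infinite ones occur, since two real points are at finite distance.\<close>

lemma isometric_UNIV_Icc:
  assumes "isometric {-\<infinity>..\<infinity>} {x..y}"
  shows "x = -\<infinity> \<and> y = \<infinity>"
proof -
  obtain f where f: "bij_betw f {-\<infinity>..\<infinity>} {x..y}"
      "\<forall>p\<in>{-\<infinity>..\<infinity>}. \<forall>q\<in>{-\<infinity>..\<infinity>}. \<delta> (f p) (f q) = \<delta> p q"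
    using assms unfolding isometric_def by blast
  have *: "\<infinity> \<in> {p, q, r} \<and> -\<infinity> \<in> {p, q, r}"
    if "\<delta> p q = \<infinity>" "\<delta> q r = \<infinity>" "\<delta> p r = \<infinity>" for p q r
    using that by (cases p; cases q; cases r) (auto simp: \<delta>_def)
  have "\<infinity> \<in> {f (-\<infinity>), f 0, f \<infinity>} \<and> -\<infinity> \<in> {f (-\<infinity>), f 0, f \<infinity>}"
    by (rule *) (use f(2) in \<open>auto simp: \<delta>_def\<close>)
  moreover have "{f (-\<infinity>), f 0, f \<infinity>} \<subseteq> {x..y}"
    using bij_betw_apply[OF f(1)] by auto
  ultimately have "\<infinity> \<in> {x..y}" "-\<infinity> \<in> {x..y}" by blast+
  then show ?thesis by auto
qed

lemma isometric_Icc: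
  assumes "isometric {x..y} {x'..y'}" "x < y" "x' < y'"
  shows "y - x = y' - x'" "x = -\<infinity> \<and> y = \<infinity> \<longleftrightarrow> x' = -\<infinity> \<and> y' = \<infinity>"
proof -
  show "y - x = y' - x'"
    using isometric_Icc_length_le[OF assms(2,1)]
      isometric_Icc_length_le[OF assms(3) isometric_sym[OF assms(1)]] by simp
  show "x = -\<infinity> \<and> y = \<infinity> \<longleftrightarrow> x' = -\<infinity> \<and> y' = \<infinity>"
    using isometric_UNIV_Icc assms(1) isometric_sym by metis
qed

section \<open>Normal forms up to units\<close>

lemma tropical_inverse: "x \<noteq> MInf \<Longrightarrow> \<exists>y. x * y = 1"
  by (cases x) (auto intro: exI[of _ "Fin (- z)" for z])

text \<open>If the corner entry \<open>p\<close> is finite, the determinant condition makes the second column a multiple of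
  the first. If it is infinite, the condition forces a whole row or column to be infinite.\<close>

lemma singular_imp_outer:
  assumes "p * s = q * r"
  shows "\<exists>u u' v v'. mat2 p q r s = outer u u' v v'"
proof (cases "p = MInf")
  case False
  then obtain x where x: "p * x = 1" using tropical_inverse by blast
  have "s = r * (x * q)"
    using assms x by (metis mult.assoc mult.commute mult.right_neutral)
  moreover have "q = p * (x * q)"
    using x by (metis mult.assoc mult.left_neutral)
  ultimately have "mat2 p q r s = outer p r 1 (x * q)"
    unfolding outer_def by (simp del: one_tropical_def)
  then show ?thesis by blast
next
  case True
  then have "q = MInf \<or> r = MInf" using assms by (metis times_tropical.simps(1) tropical_mult_eq_MInf)
  then have "mat2 p q r s = outer 0 1 r s \<or> mat2 p q r s = outer q s 0 1"
    using True by (auto simp: outer_def)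
  then show ?thesis by blast
qed

text \<open>Dividing each row by its diagonal entry, which is finite because it occurs in the larger term,
  leaves an interval matrix.\<close>

lemma diagonal_dominant_normal_form:
  assumes "ereal_of_tropical (q * r) < ereal_of_tropical (p * s)"
  shows "\<exists>\<alpha> \<beta> a b. ereal_of_tropical b < - ereal_of_tropical a \<and>
    mat2 p q r s = diag2 \<alpha> \<beta> ** interval_matrix a b"
proof -
  obtain \<alpha> \<beta> where ps: "p = Fin \<alpha>" "s = Fin \<beta>"
    using assms by (cases p; cases s) auto
  show ?thesis
    using assms unfolding ps
    by (intro exI[of _ \<alpha>] exI[of _ \<beta>] exI[of _ "Fin (- \<alpha>) * q"] exI[of _ "Fin (- \<beta>) * r"];
        cases q; cases r) (auto simp: diag2_def interval_matrix_def)
qed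

lemma nonsingular_normal_form:
  assumes "p * s \<noteq> q * r"
  shows "\<exists>\<alpha> \<beta> a b. ereal_of_tropical b < - ereal_of_tropical a \<and>
    (mat2 p q r s = diag2 \<alpha> \<beta> ** interval_matrix a b \<or>
     mat2 p q r s = swap2 ** (diag2 \<alpha> \<beta> ** interval_matrix a b))"
proof -
  have inj: "x = y" if "ereal_of_tropical x = ereal_of_tropical y" for x y
    using that by (cases x; cases y) auto
  then consider "ereal_of_tropical (q * r) < ereal_of_tropical (p * s)"
    | "ereal_of_tropical (s * p) < ereal_of_tropical (r * q)"
    using assms by (metis linorder_less_linear mult.commute)
  then show ?thesis
  proof cases
    case 1
    then show ?thesis using diagonal_dominant_normal_form by blast
  next
    case 2
    have "mat2 p q r s = swap2 ** mat2 r s p q" by (simp add: swap2_def)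
    then show ?thesis using diagonal_dominant_normal_form[OF 2] by metis
  qed
qed

lemma outer_eq_zero_iff:
  "outer u u' v v' = mat2 0 0 0 0 \<longleftrightarrow>
   \<not> ((u \<noteq> MInf \<or> u' \<noteq> MInf) \<and> (v \<noteq> MInf \<or> v' \<noteq> MInf))"
  by (auto simp: outer_def)

lemma tropical_matrix_normal_form:
  obtains (zero) "A = mat2 0 0 0 0"
  | (rank_one) u u' v v' where "u \<noteq> MInf \<or> u' \<noteq> MInf" "v \<noteq> MInf \<or> v' \<noteq> MInf" "A = outer u u' v v'"
  | (rank_two) \<alpha> \<beta> a b where "ereal_of_tropical b < - ereal_of_tropical a"
      "A = diag2 \<alpha> \<beta> ** interval_matrix a b \<or> A = swap2 ** (diag2 \<alpha> \<beta> ** interval_matrix a b)"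
proof (cases A)
  case (1 p q r s)
  show ?thesis
  proof (cases "p * s = q * r")
    case True
    then obtain u u' v v' where "A = outer u u' v v'" using singular_imp_outer 1 by metis
    then show ?thesis using outer_eq_zero_iff zero rank_one by metis
  next
    case False
    then show ?thesis using nonsingular_normal_form[OF False] rank_two 1 by metis
  qed
qed

section \<open>The D-classes as isometry classes\<close>

lemma diag2_inverse: "diag2 (- \<alpha>) (- \<beta>) ** diag2 \<alpha> \<beta> = mat 1"
  by (simp add: diag2_def mat_1_eq_mat2 del: one_tropical_def) simp

lemma diag2_inverse': "diag2 \<alpha> \<beta> ** diag2 (- \<alpha>) (- \<beta>) = mat 1"
  using diag2_inverse[of "- \<alpha>" "- \<beta>"] by simp

lemma swap2_involution: "swap2 ** swap2 = mat 1"
  by (simp add: swap2_def mat_1_eq_mat2 del: one_tropical_def zero_tropical_def)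

abbreviation (input) "trop_D \<equiv> green_D trop_matrix_monoid"

lemma trop_D_refl: "(A, A) \<in> trop_D"
  using green_D_equiv[of trop_matrix_monoid]
  by (auto simp: equiv_def refl_on_def trop_matrix_monoid_def)

lemma trop_D_sym: "(A, B) \<in> trop_D \<Longrightarrow> (B, A) \<in> trop_D"
  using green_D_equiv[of trop_matrix_monoid] by (auto simp: equiv_def dest: symD)

lemma trop_D_trans: "(A, B) \<in> trop_D \<Longrightarrow> (B, C) \<in> trop_D \<Longrightarrow> (A, C) \<in> trop_D"
  using green_D_equiv[of trop_matrix_monoid] by (auto simp: equiv_def dest: transD)

lemma trop_D_if_left_multiples: "A = P ** B \<Longrightarrow> B = Q ** A \<Longrightarrow> (A, B) \<in> trop_D"
  using green_L_subset_D[of trop_matrix_monoid] trop.green_L_iff[of A B] by blast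

lemma trop_D_if_right_multiples: "A = B ** P \<Longrightarrow> B = A ** Q \<Longrightarrow> (A, B) \<in> trop_D"
  using green_R_subset_D[of trop_matrix_monoid] trop.green_R_iff[of A B] by blast

lemma trop_D_mult_left_unit: "Q ** P = mat 1 \<Longrightarrow> (P ** A, A) \<in> trop_D"
  by (rule trop_D_if_left_multiples[of _ P _ Q]) (simp_all add: matrix_mul_assoc del: one_tropical_def)

lemma trop_D_conjugate:
  assumes "Q ** P = mat 1"
  shows "(P ** A ** Q, A) \<in> trop_D"
proof (rule trop_D_trans)
  show "(P ** A ** Q, P ** A) \<in> trop_D"
    by (rule trop_D_if_right_multiples[of _ _ Q P])
      (simp_all add: matrix_mul_assoc[symmetric] assms del: one_tropical_def)
  show "(P ** A, A) \<in> trop_D" using trop_D_mult_left_unit[OF assms] .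
qed

text \<open>For a fixed column factor, all non-zero row factors generate the same right ideal: every non-zero
  vector pairs to \<open>1\<close> with some vector, and multiplying by an outer product with that vector
  replaces the row factor by an arbitrary one. The same argument on the left changes the column
  factor.\<close>

lemma trop_D_outer:
  assumes "u \<noteq> MInf \<or> u' \<noteq> MInf" "v \<noteq> MInf \<or> v' \<noteq> MInf"
    and "w \<noteq> MInf \<or> w' \<noteq> MInf" "z \<noteq> MInf \<or> z' \<noteq> MInf"
  shows "(outer u u' v v', outer w w' z z') \<in> trop_D"
proof -
  have dual: "\<exists>x x'. u * x + u' * x' = 1" if "u \<noteq> MInf \<or> u' \<noteq> MInf" for u u'
    using that
  proof
    assume "u \<noteq> MInf"
    then obtain x where "u * x = 1" using tropical_inverse by blast
    then show ?thesis by (intro exI[of _ x] exI[of _ MInf]) simp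
  next
    assume "u' \<noteq> MInf"
    then obtain x where "u' * x = 1" using tropical_inverse by blast
    then show ?thesis by (intro exI[of _ MInf] exI[of _ x]) simp
  qed
  have mult: "outer u u' v v' ** outer x x' z z' = outer u u' z z'" if "v * x + v' * x' = 1"
    for u u' v v' x x' z z'
  proof -
    have "(s * v) * (x * t) + (s * v') * (x' * t) = s * t" for s t
    proof -
      have "(s * v) * (x * t) + (s * v') * (x' * t) = s * (v * x + v' * x') * t"
        by (simp add: algebra_simps)
      then show ?thesis using that by simp
    qed
    then show ?thesis by (simp add: outer_def)
  qed
  obtain t t' where t: "v * t + v' * t' = 1" using dual assms by blast
  obtain y y' where y: "z * y + z' * y' = 1" using dual assms by blast
  obtain k k' where k: "k * u + k' * u' = 1" using dual[OF assms(1)] by (metis mult.commute)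
  obtain l l' where l: "l * w + l' * w' = 1" using dual[OF assms(3)] by (metis mult.commute)
  have "(outer u u' v v', outer u u' z z') \<in> trop_D"
    by (rule trop_D_if_right_multiples) (rule mult[OF y, symmetric], rule mult[OF t, symmetric])
  moreover have "(outer u u' z z', outer w w' z z') \<in> trop_D"
    by (rule trop_D_if_left_multiples) (rule mult[OF l, symmetric], rule mult[OF k, symmetric])
  ultimately show ?thesis by (rule trop_D_trans)
qed

text \<open>Conjugation by a diagonal matrix translates the interval \<open>[b, -a]\<close> by \<open>t\<close>; conjugation by the swap
  reflects it.\<close>

lemma trop_D_interval_matrix_translate:
  "(interval_matrix (Fin (- t) * a) (Fin t * b), interval_matrix a b) \<in> trop_D"
proof -
  have "interval_matrix (Fin (- t) * a) (Fin t * b) =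
      diag2 0 t ** interval_matrix a b ** diag2 0 (- t)"
    by (simp add: diag2_def interval_matrix_def mult.commute)
  moreover have "diag2 0 (- t) ** diag2 0 t = mat 1" using diag2_inverse[of 0 t] by simp
  ultimately show ?thesis using trop_D_conjugate by metis
qed

lemma trop_D_interval_matrix_swap: "(interval_matrix b a, interval_matrix a b) \<in> trop_D"
proof -
  have "interval_matrix b a = swap2 ** interval_matrix a b ** swap2"
    by (simp add: swap2_def interval_matrix_def)
  then show ?thesis using trop_D_conjugate swap2_involution by metis
qed

text \<open>By the two invariants of intervals, the off-diagonal entries of both matrices are infinite equally
  often, and the intervals then differ by a translation, possibly after a reflection.\<close>

lemma trop_D_interval_matrix:
  assumes "ereal_of_tropical b < - ereal_of_tropical a" "ereal_of_tropical b' < - ereal_of_tropical a'"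
    and "isometric {ereal_of_tropical b .. - ereal_of_tropical a} {ereal_of_tropical b' .. - ereal_of_tropical a'}"
  shows "(interval_matrix a b, interval_matrix a' b') \<in> trop_D"
proof -
  note iso = isometric_Icc[OF assms(3,1,2)]
  have tr: "(interval_matrix c d, interval_matrix c' d') \<in> trop_D"
    if "c = Fin (- t) * c'" "d = Fin t * d'" for c d c' d' t
    using trop_D_interval_matrix_translate that by simp
  consider (fin) x y x' y' where "a = Fin x" "b = Fin y" "a' = Fin x'" "b' = Fin y'"
    | (ll) x x' where "a = Fin x" "b = MInf" "a' = Fin x'" "b' = MInf"
    | (lr) x y' where "a = Fin x" "b = MInf" "a' = MInf" "b' = Fin y'"
    | (rl) y x' where "a = MInf" "b = Fin y" "a' = Fin x'" "b' = MInf"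
    | (rr) y y' where "a = MInf" "b = Fin y" "a' = MInf" "b' = Fin y'"
    | (univ) "a = MInf" "b = MInf" "a' = MInf" "b' = MInf"
    using iso by (cases a; cases b; cases a'; cases b') auto
  then show ?thesis
  proof cases
    case fin
    show ?thesis using iso fin by (intro tr[of _ "y - y'"]) auto
  next
    case ll
    show ?thesis using ll by (intro tr[of _ "x' - x"]) auto
  next
    case lr
    show ?thesis
      by (rule trop_D_trans[OF trop_D_interval_matrix_swap], rule tr[of _ "x - y'"]) (use lr in auto)
  next
    case rl
    show ?thesis
      by (rule trop_D_trans[OF trop_D_interval_matrix_swap], rule tr[of _ "x' - y"]) (use rl in auto)
  next
    case rr
    show ?thesis using rr by (intro tr[of _ "y - y'"]) auto
  next
    case univ
    then show ?thesis using trop_D_refl by simp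
  qed
qed

lemma proj_column_space_mult_right_unit:
  assumes "P ** Q = mat 1"
  shows "proj_column_space (A ** P) = proj_column_space A"
proof
  show "proj_column_space (A ** P) \<subseteq> proj_column_space A"
    by (rule proj_column_space_mult_subset)
  have "A = (A ** P) ** Q"
    using assms by (simp add: matrix_mul_assoc[symmetric] del: one_tropical_def)
  then show "proj_column_space A \<subseteq> proj_column_space (A ** P)"
    using proj_column_space_mult_subset by metis
qed

text \<open>A unit on the left moves the column space by a translation or a reflection and leaves the row
  space alone.\<close>

lemma isometric_proj_column_space_left_unit:
  assumes "A = diag2 \<alpha> \<beta> ** B \<or> A = swap2 ** (diag2 \<alpha> \<beta> ** B)"
  shows "isometric (proj_column_space B) (proj_column_space A)"
proof -
  have "isometric (proj_column_space B) (proj_column_space (diag2 \<alpha> \<beta> ** B))"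
    unfolding proj_column_space_diag2 by (rule isometric_translate)
  moreover have "isometric (proj_column_space C) (proj_column_space (swap2 ** C))" for C
    unfolding proj_column_space_swap2 by (rule isometric_uminus)
  ultimately show ?thesis using assms isometric_trans by metis
qed

lemma proj_row_space_left_unit:
  assumes "A = diag2 \<alpha> \<beta> ** B \<or> A = swap2 ** (diag2 \<alpha> \<beta> ** B)"
  shows "proj_row_space A = proj_row_space B"
proof -
  let ?t = Finite_Cartesian_Product.transpose
  have d: "proj_column_space (C ** diag2 \<alpha> \<beta>) = proj_column_space C" for C
    using proj_column_space_mult_right_unit[OF diag2_inverse'] .
  have s: "proj_column_space (C ** swap2) = proj_column_space C" for C
    using proj_column_space_mult_right_unit[OF swap2_involution] .
  have "?t (diag2 \<alpha> \<beta>) = diag2 \<alpha> \<beta>" "?t swap2 = swap2"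
    by (simp_all add: diag2_def swap2_def)
  then show ?thesis
    using assms d s by (auto simp: proj_row_space_eq matrix_transpose_mul)
qed

lemma uminus_image_Icc: "uminus ` {x..y} = {- y .. - x}" for x y :: ereal
proof (intro Set.set_eqI iffI)
  fix z assume "z \<in> {- y .. - x}"
  then have "- z \<in> {x..y}"
    by (auto simp: ereal_uminus_le_reorder intro: ereal_minus_le_minus[THEN iffD1])
  then show "z \<in> uminus ` {x..y}" by (metis ereal_uminus_uminus imageI)
qed auto

text \<open>Both sides change only by isometries when \<open>A\<close> is multiplied by a unit, and for an interval matrix
  transposition reflects \<open>[b, -a]\<close> to \<open>[a, -b]\<close>.\<close>

lemma isometric_proj_row_column_space:
  "isometric (proj_row_space A) (proj_column_space A)"
proof (cases A rule: tropical_matrix_normal_form)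
  case zero
  then show ?thesis by (simp add: proj_row_space_eq isometric_refl)
next
  case (rank_one u u' v v')
  have "Finite_Cartesian_Product.transpose A = outer v v' u u'"
    unfolding rank_one(3) by (simp add: outer_def mult.commute)
  then show ?thesis
    using rank_one proj_column_space_outer isometric_singletons by (simp add: proj_row_space_eq)
next
  case (rank_two \<alpha> \<beta> a b)
  have "Finite_Cartesian_Product.transpose (interval_matrix a b) = interval_matrix b a"
    by (simp add: interval_matrix_def)
  moreover have "ereal_of_tropical a < - ereal_of_tropical b"
    using rank_two(1) by (simp add: ereal_less_uminus_reorder)
  ultimately have "proj_row_space (interval_matrix a b) =
      uminus ` proj_column_space (interval_matrix a b)"
    using rank_two(1) by (simp add: proj_row_space_eq proj_column_space_interval_matrix uminus_image_Icc)
  then have "isometric (proj_row_space (interval_matrix a b)) (proj_column_space (interval_matrix a b))"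
    using isometric_uminus isometric_sym by metis
  then show ?thesis
    using isometric_proj_column_space_left_unit[OF rank_two(2)] proj_row_space_left_unit[OF rank_two(2)]
      isometric_trans by metis
qed

text \<open>R preserves the column space. L preserves the row space, whose projection is isometric to that of
  the column space; hence both relations, and with them D, respect the isometry type of the
  projective column space.\<close>

lemma trop_D_imp_isometric:
  assumes "(A, B) \<in> trop_D"
  shows "isometric (proj_column_space A) (proj_column_space B)"
proof -
  let ?r = "{(A, B). isometric (proj_column_space A) (proj_column_space B)}"
  have "trop_D \<subseteq> ?r"
  proof (rule green_D_least)
    show "equiv (carrier trop_matrix_monoid) ?r"
      by (rule equivI) (auto simp: refl_on_def trop_matrix_monoid_def isometric_refl
          intro: symI transI isometric_sym isometric_trans)
    show "green_R trop_matrix_monoid \<subseteq> ?r"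
    proof clarify
      fix A B assume "(A, B) \<in> green_R trop_matrix_monoid"
      then have "proj_column_space A = proj_column_space B"
        unfolding trop.green_R_iff using proj_column_space_mult_subset
        by (metis subset_antisym)
      then show "isometric (proj_column_space A) (proj_column_space B)"
        by (simp add: isometric_refl)
    qed
    show "green_L trop_matrix_monoid \<subseteq> ?r"
    proof clarify
      fix A B assume "(A, B) \<in> green_L trop_matrix_monoid"
      then obtain X Y where "A = X ** B" "B = Y ** A"
        unfolding trop.green_L_iff by blast
      then have "proj_row_space A \<subseteq> proj_row_space B" "proj_row_space B \<subseteq> proj_row_space A"
        unfolding proj_row_space_eq using proj_column_space_mult_subset matrix_transpose_mul by metis+
      then have "proj_row_space A = proj_row_space B" by blast
      then show "isometric (proj_column_space A) (proj_column_space B)"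
        using isometric_proj_row_column_space isometric_sym isometric_trans by metis
    qed
  qed
  then show ?thesis using assms by blast
qed

lemma trop_D_representative:
  obtains (zero) "A = mat2 0 0 0 0" "proj_column_space A = {}"
  | (rank_one) u u' v v' where "u \<noteq> MInf \<or> u' \<noteq> MInf" "v \<noteq> MInf \<or> v' \<noteq> MInf"
      "A = outer u u' v v'" "proj_column_space A = {proj_coords u u'}"
  | (rank_two) a b where "ereal_of_tropical b < - ereal_of_tropical a"
      "(A, interval_matrix a b) \<in> trop_D"
      "isometric (proj_column_space A) {ereal_of_tropical b .. - ereal_of_tropical a}"
proof (cases A rule: tropical_matrix_normal_form)
  case zero
  then show ?thesis using that(1) proj_column_space_zero by blast
next
  case (rank_one u u' v v')
  then show ?thesis using that(2) proj_column_space_outer by blast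
next
  case (rank_two \<alpha> \<beta> a b)
  have d: "(diag2 \<alpha> \<beta> ** B, B) \<in> trop_D" and s: "(swap2 ** B, B) \<in> trop_D" for B
    using trop_D_mult_left_unit diag2_inverse swap2_involution by blast+
  have "(A, interval_matrix a b) \<in> trop_D"
    using rank_two(2) d s trop_D_trans by metis
  then show ?thesis
    using that(3)[OF rank_two(1)] trop_D_imp_isometric
      proj_column_space_interval_matrix[OF rank_two(1)] by metis
qed

lemma isometric_singleton_Icc:
  "x < y \<Longrightarrow> \<not> isometric {z} {x..y}" "x < y \<Longrightarrow> \<not> isometric {x..y} {z}"
  by (metis isometric_singleton_cases Icc_not_singleton isometric_sym)+

text \<open>Each matrix is D-related to zero, to an outer product or to an interval matrix, and the three kinds
  are told apart by the number of points of the projective column space. Within each kind the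
  preceding lemmas show that the isometry type suffices.\<close>

theorem trop_D_iff_isometric:
  "(A, B) \<in> trop_D \<longleftrightarrow> isometric (proj_column_space A) (proj_column_space B)"
proof
  assume iso: "isometric (proj_column_space A) (proj_column_space B)"
  show "(A, B) \<in> trop_D"
  proof (cases A rule: trop_D_representative)
    case zero
    then have "proj_column_space B = {}" using iso isometric_empty_iff by metis
    then show ?thesis
    proof (cases B rule: trop_D_representative)
      case (rank_two a b)
      then show ?thesis using \<open>proj_column_space B = {}\<close> isometric_empty_iff(2)
        by (metis atLeastatMost_empty_iff less_imp_le)
    qed (use zero trop_D_refl in auto)
  next
    case A: (rank_one u u' v v')
    obtain y where y: "proj_column_space B = {y}"
      using isometric_singleton_cases[OF iso A(4)] .
    show ?thesis
    proof (cases B rule: trop_D_representative)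
      case (rank_one w w' z z')
      then show ?thesis using trop_D_outer A by metis
    next
      case (rank_two a b)
      then show ?thesis using y isometric_singleton_Icc by metis
    qed (use y in auto)
  next
    case A: (rank_two a b)
    have iso': "isometric {ereal_of_tropical b..- ereal_of_tropical a} (proj_column_space B)"
      using A(3) iso isometric_sym isometric_trans by metis
    show ?thesis
    proof (cases B rule: trop_D_representative)
      case zero
      then show ?thesis
        using iso' A(1) isometric_empty_iff(1) by (metis atLeastatMost_empty_iff less_imp_le)
    next
      case (rank_one w w' z z')
      then show ?thesis using iso' A(1) isometric_singleton_Icc by metis
    next
      case B: (rank_two a' b')
      have "(interval_matrix a b, interval_matrix a' b') \<in> trop_D"
        using trop_D_interval_matrix[OF A(1) B(1)] iso' B(3) isometric_trans by blast
      then show ?thesis using A(2) B(2) trop_D_sym trop_D_trans by blast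
    qed
  qed
qed (rule trop_D_imp_isometric)

lemma mem_isometry_class_iff: "A \<in> isometry_class M \<longleftrightarrow> isometric (proj_column_space A) M"
  unfolding isometry_class_def using isometric_proj_row_column_space isometric_trans by blast

lemma isometry_class_eq_D_class:
  assumes "A \<in> isometry_class M"
  shows "isometry_class M = trop_D `` {A}"
proof (intro Set.set_eqI iffI)
  have A: "isometric (proj_column_space A) M" using assms mem_isometry_class_iff by blast
  fix B
  show "B \<in> trop_D `` {A}" if "B \<in> isometry_class M"
    using isometric_trans[OF A isometric_sym] that
    by (simp add: trop_D_iff_isometric mem_isometry_class_iff)
  show "B \<in> isometry_class M" if "B \<in> trop_D `` {A}"
    using isometric_trans[OF isometric_sym A] that
    by (simp add: trop_D_iff_isometric mem_isometry_class_iff)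
qed

section \<open>Idempotents\<close>

lemma outer_mult:
  "outer u u' v v' ** outer w w' z z' = outer ((v * w + v' * w') * u) ((v * w + v' * w') * u') z z'"
  by (simp add: outer_def algebra_simps)

lemma outer_scale_cancel:
  assumes "u \<noteq> MInf \<or> u' \<noteq> MInf" "v \<noteq> MInf \<or> v' \<noteq> MInf"
    and "outer (k * u) (k * u') v v' = outer (l * u) (l * u') v v'"
  shows "k = l"
proof -
  have c: "k = l" if "k * x * y = l * x * y" "x \<noteq> MInf" "y \<noteq> MInf" for x y
    using that by (cases k; cases l; cases x; cases y) auto
  show ?thesis
    using assms unfolding outer_def mat2_eq_iff by (elim disjE conjE) (rule c; assumption)+
qed

text \<open>If the antidiagonal term dominated, the diagonal entries of an idempotent would be negative, while
  its finite entry \<open>q\<close> would require one of them to be zero. If the diagonal term dominates, both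
  diagonal entries are at most zero, and a negative one would have to be produced by \<open>q * r\<close>, which
  then could not be dominated.\<close>

lemma nonsingular_idempotent:
  assumes "p * s \<noteq> q * r" "mat2 p q r s ** mat2 p q r s = mat2 p q r s"
  shows "p = 1 \<and> s = 1 \<and> ereal_of_tropical q < - ereal_of_tropical r"
  using assms
  by (cases p; cases q; cases r; cases s) (auto simp: max_def split: if_splits)

lemma idempotent_cases:
  assumes "e ** e = e"
  obtains (zero) "e = mat2 0 0 0 0"
  | (rank_one) u u' v v' where "u \<noteq> MInf \<or> u' \<noteq> MInf" "v \<noteq> MInf \<or> v' \<noteq> MInf"
      "v * u + v' * u' = 1" "e = outer u u' v v'"
  | (rank_two) a b where "ereal_of_tropical b < - ereal_of_tropical a" "e = interval_matrix a b"
proof (cases e)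
  case (1 p q r s)
  show ?thesis
  proof (cases "p * s = q * r")
    case True
    then obtain u u' v v' where e: "e = outer u u' v v'" using singular_imp_outer 1 by metis
    show ?thesis
    proof (cases "(u \<noteq> MInf \<or> u' \<noteq> MInf) \<and> (v \<noteq> MInf \<or> v' \<noteq> MInf)")
      case True
      have "outer ((v * u + v' * u') * u) ((v * u + v' * u') * u') v v' = outer (1 * u) (1 * u') v v'"
        using assms unfolding e outer_mult by simp
      then have "v * u + v' * u' = 1" using outer_scale_cancel True by blast
      then show ?thesis using rank_one True e by blast
    next
      case False
      then show ?thesis using zero outer_eq_zero_iff e by metis
    qed
  next
    case False
    have "ereal_of_tropical r < - ereal_of_tropical q" "e = interval_matrix q r"
      using nonsingular_idempotent[OF False] assms unfolding 1
      by (auto simp: interval_matrix_def ereal_less_uminus_reorder)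
    then show ?thesis by (rule rank_two)
  qed
qed

section \<open>Groups of local units\<close>

lemma mem_local_units_tropical:
  "X \<in> local_units trop_matrix_monoid e \<longleftrightarrow> e ** X = X \<and> X ** e = X \<and>
     (\<exists>Y. e ** Y = Y \<and> Y ** e = Y \<and> X ** Y = e \<and> Y ** X = e)"
  by (simp add: local_units_def trop_matrix_monoid_def)

lemma local_units_zero: "local_units trop_matrix_monoid (mat2 0 0 0 0) \<subseteq> {mat2 0 0 0 0}"
proof
  fix X assume "X \<in> local_units trop_matrix_monoid (mat2 0 0 0 0)"
  then have "mat2 0 0 0 0 ** X = X" unfolding mem_local_units_tropical by blast
  then show "X \<in> {mat2 0 0 0 0}" by (cases X) auto
qed

text \<open>Multiplying \<open>X\<close> by the outer product \<open>e\<close> from both sides returns a scalar multiple of \<open>e\<close>, and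
  invertibility excludes the scalar minus infinity.\<close>

lemma local_units_outer:
  assumes uv: "u \<noteq> MInf \<or> u' \<noteq> MInf" "v \<noteq> MInf \<or> v' \<noteq> MInf"
    and X: "X \<in> local_units trop_matrix_monoid (outer u u' v v')"
  shows "\<exists>t. X = outer (Fin t * u) (Fin t * u') v v'"
proof -
  let ?e = "outer u u' v v'"
  obtain Y where eX: "?e ** X = X" "X ** ?e = X" and XY: "X ** Y = ?e"
    using X unfolding mem_local_units_tropical by blast
  obtain p q r s where pqrs: "X = mat2 p q r s" by (cases X)
  have "X = (?e ** X) ** ?e" using eX by simp
  also have "?e ** X = outer u u' (v * p + v' * r) (v * q + v' * s)"
    by (simp add: outer_def pqrs algebra_simps)
  finally obtain k where k: "X = outer (k * u) (k * u') v v'"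
    unfolding outer_mult by blast
  have "k \<noteq> MInf"
  proof
    assume "k = MInf"
    then have "X = mat2 0 0 0 0" using k by (simp add: outer_def)
    then have "?e = mat2 0 0 0 0" using XY by (cases Y) auto
    then show False using uv outer_eq_zero_iff by blast
  qed
  then show ?thesis using k by (cases k) auto
qed

lemma ereal_of_tropical_add_ge:
  assumes "x + y = z"
  shows "ereal_of_tropical x \<le> ereal_of_tropical z" "ereal_of_tropical y \<le> ereal_of_tropical z"
  using assms by (cases x; cases y; auto)+

text \<open>The two bounds say \<open>x + c \<le> z \<le> c - x'\<close> in ordinary notation, and both ends coincide. In the
  computation of the local units below every entry is pinned down in this way: one bound comes from
  the invariance under the idempotent, the other from the product with the inverse.\<close>

lemma tropical_sandwich:
  assumes "x * x' = 1" "ereal_of_tropical (x * c) \<le> ereal_of_tropical z"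
    "ereal_of_tropical (x' * z) \<le> ereal_of_tropical c"
  shows "z = x * c"
  using assms by (cases x; cases x'; cases c; cases z) auto

lemma tropical_mult_eq_1_cases:
  assumes "x * x' = 1"
  obtains t where "x = Fin t" "x' = Fin (- t)"
  using assms by (cases x; cases x') (auto simp: add_eq_0_iff)

text \<open>A local unit has the same column space as the idempotent, so its columns are multiples of the two
  extremal columns of the idempotent, in the same or in the opposite order; the same holds for its
  rows. Comparing both descriptions yields the conditions on the scaling factors.\<close>

lemma local_units_interval_matrix:
  assumes ab: "ereal_of_tropical b < - ereal_of_tropical a"
    and X: "X \<in> local_units trop_matrix_monoid (interval_matrix a b)"
  obtains (diagonal) \<alpha> \<beta> where "Fin \<alpha> * a = Fin \<beta> * a" "Fin \<alpha> * b = Fin \<beta> * b"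
      "X = mat2 (Fin \<alpha>) (Fin \<alpha> * a) (Fin \<alpha> * b) (Fin \<beta>)"
  | (antidiagonal) \<alpha> \<beta> where "Fin \<alpha> * b = Fin \<beta> * a"
      "X = mat2 (Fin \<alpha> * b) (Fin \<alpha>) (Fin \<beta>) (Fin \<alpha> * b)"
proof -
  obtain p q r s where pqrs: "X = mat2 p q r s" by (cases X)
  obtain Y where Y: "interval_matrix a b ** X = X" "X ** interval_matrix a b = X"
    "interval_matrix a b ** Y = Y" "Y ** interval_matrix a b = Y"
    "X ** Y = interval_matrix a b" "Y ** X = interval_matrix a b"
    using X unfolding mem_local_units_tropical by blast
  obtain p' q' r' s' where pqrs': "Y = mat2 p' q' r' s'" by (cases Y)
  have eqs: "p + a * r = p" "q + a * s = q" "b * p + r = r" "b * q + s = s"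
    "p + q * b = p" "p * a + q = q" "r + s * b = r" "r * a + s = s"
    "p' + a * r' = p'" "b * p' + r' = r'"
    "p' * a + q' = q'" "r' * a + s' = s'"
    "p * p' + q * r' = 1" "p * q' + q * s' = a" "r * p' + s * r' = b" "r * q' + s * s' = 1"
    "p' * q + q' * s = a" "r' * p + s' * r = b"
    using Y unfolding pqrs pqrs' interval_matrix_def mat2_mult mat2_eq_iff by simp_all
  note le = eqs[THEN ereal_of_tropical_add_ge(1)] eqs[THEN ereal_of_tropical_add_ge(2)]
  have sum1: "x = 1 \<or> y = 1" if "x + y = 1" for x y :: tropical
    using that by (cases x; cases y) (auto simp: max_def split: if_splits)
  \<comment> \<open>the dominated term \<open>a * b < 1\<close> cannot contribute to a diagonal entry \<open>1\<close> of a product\<close>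
  have not1: "x * b * (x' * a) \<noteq> 1" "x * a * (x' * b) \<noteq> 1" if "x * x' = 1" for x x'
    using that ab by (cases x; cases x'; cases a; cases b; auto)+
  \<comment> \<open>the maximum defining the first diagonal entry of \<open>X ** Y\<close> is attained by one of its two terms,
    which decides whether \<open>X\<close> fixes or exchanges the two extremal columns\<close>
  consider "p * p' = 1" | "q * r' = 1" using sum1[OF eqs(13)] by blast
  then show ?thesis
  proof cases
    case 1
    then have inv: "p' * p = 1" by (simp add: mult.commute)
    have q: "q = p * a" by (rule tropical_sandwich[OF 1]) (use le in \<open>simp_all add: mult.commute\<close>)
    have r: "r = p * b" by (rule tropical_sandwich[OF 1]) (use le in \<open>simp_all add: mult.commute\<close>)
    have q': "q' = p' * a" by (rule tropical_sandwich[OF inv]) (use le in \<open>simp_all add: mult.commute\<close>)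
    have s: "s * s' = 1" using sum1[OF eqs(16)] not1[OF 1] r q' by metis
    have qs: "q = s * a" by (rule tropical_sandwich[OF s]) (use le in \<open>simp_all add: mult.commute\<close>)
    have rs: "r = s * b" by (rule tropical_sandwich[OF s]) (use le in \<open>simp_all add: mult.commute\<close>)
    obtain \<alpha> \<beta> where "p = Fin \<alpha>" "s = Fin \<beta>"
      using tropical_mult_eq_1_cases 1 s by metis
    then show ?thesis using diagonal[of \<alpha> \<beta>] q r qs rs pqrs by simp
  next
    case 2
    then have inv: "r' * q = 1" by (simp add: mult.commute)
    have p: "p = q * b" by (rule tropical_sandwich[OF 2]) (use le in \<open>simp_all add: mult.commute\<close>)
    have s: "s = q * b" by (rule tropical_sandwich[OF 2]) (use le in \<open>simp_all add: mult.commute\<close>)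
    have s': "s' = r' * a" by (rule tropical_sandwich[OF inv]) (use le in \<open>simp_all add: mult.commute\<close>)
    have r: "r * q' = 1" using sum1[OF eqs(16)] not1[OF 2] s s' by metis
    have pr: "p = r * a" by (rule tropical_sandwich[OF r]) (use le in \<open>simp_all add: mult.commute\<close>)
    obtain \<alpha> \<beta> where "q = Fin \<alpha>" "r = Fin \<beta>"
      using tropical_mult_eq_1_cases 2 r by metis
    then show ?thesis using antidiagonal[of \<alpha> \<beta>] p s pr pqrs by simp
  qed
qed

section \<open>The maximal subgroups as abstract groups\<close>

lemma carrier_sym_group_2: "carrier (sym_group 2) = {id, Transposition.transpose 1 2}"
proof -
  have "{1..2::nat} = {1, 2}" by auto
  then show ?thesis
    by (auto simp: sym_group_carrier permutes_doubleton_iff)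
qed

lemma transpose_neq_id: "Transposition.transpose 1 2 \<noteq> (id :: nat \<Rightarrow> nat)"
  by (metis id_apply numeral_eq_one_iff transpose_apply_first semiring_norm(85))

text \<open>The concrete isomorphisms below only ask whether a permutation is trivial, and this is how the
  composition looks from that viewpoint.\<close>

lemma sym_group_2_comp_eq_id_iff:
  assumes "\<sigma> \<in> carrier (sym_group 2)" "\<tau> \<in> carrier (sym_group 2)"
  shows "\<sigma> \<circ> \<tau> = id \<longleftrightarrow> (\<sigma> = id \<longleftrightarrow> \<tau> = id)"
  using assms transpose_neq_id unfolding carrier_sym_group_2 by auto

lemma real_add_group_group: "group real_add_group"
  by (rule groupI) (auto simp: real_add_group_def intro: exI[of _ "- x" for x])

lemma wreath_S2_simps:
  "carrier (wreath_S2 G) = (carrier G \<times> carrier G) \<times> carrier (sym_group 2)"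
  "monoid.mult (wreath_S2 G) x y =
     (monoid.mult (G \<times>\<times> G) (fst x) (swap_action (snd x) (fst y)), snd x \<circ> snd y)"
  "one (wreath_S2 G) = ((one G, one G), id)"
  by (simp_all add: wreath_S2_def semidirect_product_def sym_group_def case_prod_beta)

lemma wreath_S2_real_mult:
  "monoid.mult (wreath_S2 real_add_group) ((\<alpha>, \<beta>), \<sigma>) ((\<alpha>', \<beta>'), \<tau>) =
     ((if \<sigma> = id then (\<alpha> + \<alpha>', \<beta> + \<beta>') else (\<alpha> + \<beta>', \<beta> + \<alpha>')), \<sigma> \<circ> \<tau>)"
  by (simp add: wreath_S2_simps swap_action_def real_add_group_def)

lemma wreath_S2_real_group: "group (wreath_S2 real_add_group)"
proof (rule groupI)
  have c: "carrier (wreath_S2 real_add_group) = UNIV \<times> carrier (sym_group 2)"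
    by (simp add: wreath_S2_simps real_add_group_def)
  have comp: "\<sigma> \<circ> \<tau> \<in> carrier (sym_group 2)"
    if "\<sigma> \<in> carrier (sym_group 2)" "\<tau> \<in> carrier (sym_group 2)" for \<sigma> \<tau>
    using that unfolding sym_group_carrier by (simp add: permutes_compose)
  have one: "\<one>\<^bsub>wreath_S2 real_add_group\<^esub> = ((0, 0), id)"
    by (simp add: wreath_S2_simps real_add_group_def)
  fix x assume x: "x \<in> carrier (wreath_S2 real_add_group)"
  obtain \<alpha> \<beta> \<sigma> where x': "x = ((\<alpha>, \<beta>), \<sigma>)" by (metis prod.exhaust)
  have \<sigma>: "\<sigma> \<in> carrier (sym_group 2)" using x unfolding x' c by simp
  show "\<one>\<^bsub>wreath_S2 real_add_group\<^esub> \<otimes>\<^bsub>wreath_S2 real_add_group\<^esub> x = x"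
    by (simp add: one x' wreath_S2_real_mult)
  have "\<sigma> \<circ> \<sigma> = id" using sym_group_2_comp_eq_id_iff[OF \<sigma> \<sigma>] by simp
  then show "\<exists>y\<in>carrier (wreath_S2 real_add_group).
      y \<otimes>\<^bsub>wreath_S2 real_add_group\<^esub> x = \<one>\<^bsub>wreath_S2 real_add_group\<^esub>"
    using \<sigma>
    by (intro bexI[of _ "(if \<sigma> = id then (- \<alpha>, - \<beta>) else (- \<beta>, - \<alpha>), \<sigma>)"])
       (simp_all add: c one x' wreath_S2_real_mult)
  fix y assume y: "y \<in> carrier (wreath_S2 real_add_group)"
  obtain \<alpha>' \<beta>' \<tau> where y': "y = ((\<alpha>', \<beta>'), \<tau>)" by (metis prod.exhaust)
  have \<tau>: "\<tau> \<in> carrier (sym_group 2)" using y unfolding y' c by simp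
  show "x \<otimes>\<^bsub>wreath_S2 real_add_group\<^esub> y \<in> carrier (wreath_S2 real_add_group)"
    using comp[OF \<sigma> \<tau>] by (simp add: x' y' c wreath_S2_real_mult)
  fix z assume "z \<in> carrier (wreath_S2 real_add_group)"
  obtain \<alpha>'' \<beta>'' \<rho> where z': "z = ((\<alpha>'', \<beta>''), \<rho>)" by (metis prod.exhaust)
  show "x \<otimes>\<^bsub>wreath_S2 real_add_group\<^esub> y \<otimes>\<^bsub>wreath_S2 real_add_group\<^esub> z =
      x \<otimes>\<^bsub>wreath_S2 real_add_group\<^esub> (y \<otimes>\<^bsub>wreath_S2 real_add_group\<^esub> z)"
    using sym_group_2_comp_eq_id_iff[OF \<sigma> \<tau>]
    by (auto simp: x' y' z' wreath_S2_real_mult comp_assoc)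
next
  show "\<one>\<^bsub>wreath_S2 real_add_group\<^esub> \<in> carrier (wreath_S2 real_add_group)"
    by (simp add: wreath_S2_simps real_add_group_def carrier_sym_group_2)
qed

lemma one_in_sym_group_2: "id \<in> carrier (sym_group 2)" "Transposition.transpose 1 2 \<in> carrier (sym_group 2)"
  by (simp_all add: carrier_sym_group_2)

lemma maximal_subgroup_zero:
  assumes "is_maximal_subgroup trop_matrix_monoid (mat2 0 0 0 0) H"
  shows "sub_monoid_struct trop_matrix_monoid (mat2 0 0 0 0) H \<cong> singleton_group ()"
proof (rule trop.maximal_subgroup_iso[OF assms, where f = "\<lambda>_. mat2 0 0 0 0"])
  show "local_units trop_matrix_monoid (mat2 0 0 0 0)
      \<subseteq> (\<lambda>_. mat2 0 0 0 0) ` carrier (singleton_group ())"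
    using local_units_zero by simp
qed (simp_all add: inj_on_def)

lemma maximal_subgroup_outer:
  assumes uv: "u \<noteq> MInf \<or> u' \<noteq> MInf" "v \<noteq> MInf \<or> v' \<noteq> MInf" "v * u + v' * u' = 1"
    and H: "is_maximal_subgroup trop_matrix_monoid (outer u u' v v') H"
  shows "sub_monoid_struct trop_matrix_monoid (outer u u' v v') H \<cong> real_add_group"
proof (rule trop.maximal_subgroup_iso[OF H real_add_group_group,
      where f = "\<lambda>t. outer (Fin t * u) (Fin t * u') v v'"])
  have "outer (Fin (s + t) * u) (Fin (s + t) * u') v v' =
      outer (Fin s * u) (Fin s * u') v v' ** outer (Fin t * u) (Fin t * u') v v'" for s t
  proof -
    have "v * (Fin t * u) + v' * (Fin t * u') = Fin t * (v * u + v' * u')"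
      by (simp add: algebra_simps)
    then have *: "v * (Fin t * u) + v' * (Fin t * u') = Fin t" using uv(3) by simp
    have "Fin (s + t) * x = Fin t * (Fin s * x)" for x
      by (cases x) auto
    then show ?thesis unfolding outer_mult * by simp
  qed
  then show "outer (Fin (x \<otimes>\<^bsub>real_add_group\<^esub> y) * u) (Fin (x \<otimes>\<^bsub>real_add_group\<^esub> y) * u') v v' =
      outer (Fin x * u) (Fin x * u') v v' ** outer (Fin y * u) (Fin y * u') v v'" for x y
    by (simp add: real_add_group_def)
  show "outer (Fin \<one>\<^bsub>real_add_group\<^esub> * u) (Fin \<one>\<^bsub>real_add_group\<^esub> * u') v v' = outer u u' v v'"
    by (simp add: real_add_group_def)
  show "inj_on (\<lambda>t. outer (Fin t * u) (Fin t * u') v v') (carrier real_add_group)"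
    using outer_scale_cancel[OF uv(1,2)] by (intro inj_onI) blast
  show "local_units trop_matrix_monoid (outer u u' v v')
      \<subseteq> (\<lambda>t. outer (Fin t * u) (Fin t * u') v v') ` carrier real_add_group"
    using local_units_outer[OF uv(1,2)] by (auto simp: real_add_group_def)
qed simp_all

text \<open>One finite off-diagonal entry forces equal scaling factors, and it rules out the antidiagonal
  local units, whose two scalings would have to match a finite number with minus infinity.\<close>

lemma maximal_subgroup_half_line:
  assumes ab: "(a = MInf) \<noteq> (b = MInf)"
    and H: "is_maximal_subgroup trop_matrix_monoid (interval_matrix a b) H"
  shows "sub_monoid_struct trop_matrix_monoid (interval_matrix a b) H \<cong> real_add_group"
proof (rule trop.maximal_subgroup_iso[OF H real_add_group_group,
      where f = "\<lambda>t. mat2 (Fin t) (Fin t * a) (Fin t * b) (Fin t)"])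
  show "mat2 (Fin (x \<otimes>\<^bsub>real_add_group\<^esub> y)) (Fin (x \<otimes>\<^bsub>real_add_group\<^esub> y) * a)
       (Fin (x \<otimes>\<^bsub>real_add_group\<^esub> y) * b) (Fin (x \<otimes>\<^bsub>real_add_group\<^esub> y)) =
      mat2 (Fin x) (Fin x * a) (Fin x * b) (Fin x) ** mat2 (Fin y) (Fin y * a) (Fin y * b) (Fin y)" for x y
    using ab by (cases a; cases b) (auto simp: real_add_group_def)
  show "local_units trop_matrix_monoid (interval_matrix a b)
      \<subseteq> (\<lambda>t. mat2 (Fin t) (Fin t * a) (Fin t * b) (Fin t)) ` carrier real_add_group"
  proof
    fix X assume X: "X \<in> local_units trop_matrix_monoid (interval_matrix a b)"
    have lt: "ereal_of_tropical b < - ereal_of_tropical a"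
      using ab by (cases a; cases b) auto
    show "X \<in> (\<lambda>t. mat2 (Fin t) (Fin t * a) (Fin t * b) (Fin t)) ` carrier real_add_group"
      using lt X
    proof (cases rule: local_units_interval_matrix)
      case (diagonal \<alpha> \<beta>)
      then have "\<alpha> = \<beta>" using ab by (cases a; cases b) auto
      then show ?thesis using diagonal by (auto simp: real_add_group_def)
    next
      case (antidiagonal \<alpha> \<beta>)
      then have False using ab by (cases a; cases b) auto
      then show ?thesis ..
    qed
  qed
qed (auto simp: interval_matrix_def real_add_group_def inj_on_def)

text \<open>The antidiagonal local units satisfy \<open>\<alpha> + y = \<beta> + x\<close>. They are the real multiples of one
  involution, obtained for \<open>\<alpha> = (x - y) / 2\<close>, which reflects the interval at its midpoint. This
  normalisation makes the group a direct product.\<close>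

lemma maximal_subgroup_segment:
  assumes xy: "x + y < 0"
    and H: "is_maximal_subgroup trop_matrix_monoid (interval_matrix (Fin x) (Fin y)) H"
  shows "sub_monoid_struct trop_matrix_monoid (interval_matrix (Fin x) (Fin y)) H
     \<cong> real_add_group \<times>\<times> sym_group 2"
proof -
  define f where "f = (\<lambda>(t, \<sigma>). if \<sigma> = (id :: nat \<Rightarrow> nat)
    then mat2 (Fin t) (Fin (t + x)) (Fin (t + y)) (Fin t)
    else mat2 (Fin (t + (x + y) / 2)) (Fin (t + (x - y) / 2)) (Fin (t + (y - x) / 2)) (Fin (t + (x + y) / 2)))"
  have lt: "ereal_of_tropical (Fin y) < - ereal_of_tropical (Fin x)" using xy by simp
  show ?thesis
  proof (rule trop.maximal_subgroup_iso[OF H DirProd_group[OF real_add_group_group sym_group_is_group],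
        where f = f])
    fix g h assume gh: "g \<in> carrier (real_add_group \<times>\<times> sym_group 2)"
      "h \<in> carrier (real_add_group \<times>\<times> sym_group 2)"
    obtain s \<sigma> t \<tau> where g: "g = (s, \<sigma>)" and h: "h = (t, \<tau>)" by (metis prod.exhaust)
    have c: "\<sigma> \<in> carrier (sym_group 2)" "\<tau> \<in> carrier (sym_group 2)" using gh g h by auto
    have m: "g \<otimes>\<^bsub>real_add_group \<times>\<times> sym_group 2\<^esub> h = (s + t, \<sigma> \<circ> \<tau>)"
      by (simp add: g h real_add_group_def sym_group_mult)
    show "f (g \<otimes>\<^bsub>real_add_group \<times>\<times> sym_group 2\<^esub> h) = f g ** f h"
      unfolding m unfolding g h f_def prod.case sym_group_2_comp_eq_id_iff[OF c]
      using xy by (cases "\<sigma> = id"; cases "\<tau> = id") (auto simp: max_def field_simps)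
  next
    show "f \<one>\<^bsub>real_add_group \<times>\<times> sym_group 2\<^esub> = interval_matrix (Fin x) (Fin y)"
      by (simp add: f_def real_add_group_def sym_group_one interval_matrix_def)
    show "inj_on f (carrier (real_add_group \<times>\<times> sym_group 2))"
    proof (rule inj_onI)
      fix g h assume gh: "g \<in> carrier (real_add_group \<times>\<times> sym_group 2)"
        "h \<in> carrier (real_add_group \<times>\<times> sym_group 2)" and eq: "f g = f h"
      obtain s \<sigma> t \<tau> where g: "g = (s, \<sigma>)" and h: "h = (t, \<tau>)" by (metis prod.exhaust)
      have "\<sigma> = id \<longleftrightarrow> \<tau> = id" "s = t"
        using eq xy unfolding g h f_def by (auto split: if_splits simp: field_simps)
      then show "g = h" using gh g h by (auto simp: carrier_sym_group_2)
    qed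
    show "local_units trop_matrix_monoid (interval_matrix (Fin x) (Fin y))
        \<subseteq> f ` carrier (real_add_group \<times>\<times> sym_group 2)"
    proof
      fix X assume X: "X \<in> local_units trop_matrix_monoid (interval_matrix (Fin x) (Fin y))"
      show "X \<in> f ` carrier (real_add_group \<times>\<times> sym_group 2)"
        using lt X
      proof (cases rule: local_units_interval_matrix)
        case (diagonal \<alpha> \<beta>)
        then have "X = f (\<alpha>, id)" by (simp add: f_def)
        then show ?thesis using one_in_sym_group_2 by (intro image_eqI) (auto simp: real_add_group_def)
      next
        case (antidiagonal \<alpha> \<beta>)
        then have "X = f (\<alpha> - (x - y) / 2, Transposition.transpose 1 2)"
          using transpose_neq_id by (auto simp: f_def field_simps)
        then show ?thesis using one_in_sym_group_2 by (intro image_eqI) (auto simp: real_add_group_def)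
      qed
    qed
  qed simp
qed

text \<open>Here the idempotent is the identity matrix and its local units are all invertible matrices. An
  antidiagonal one is a diagonal matrix times the swap, and moving the swap past a diagonal matrix
  exchanges the two entries.\<close>

lemma maximal_subgroup_line:
  assumes H: "is_maximal_subgroup trop_matrix_monoid (interval_matrix MInf MInf) H"
  shows "sub_monoid_struct trop_matrix_monoid (interval_matrix MInf MInf) H
     \<cong> wreath_S2 real_add_group"
proof -
  define f where "f = (\<lambda>((\<alpha>, \<beta>), \<sigma>). if \<sigma> = (id :: nat \<Rightarrow> nat)
    then mat2 (Fin \<alpha>) MInf MInf (Fin \<beta>) else mat2 MInf (Fin \<alpha>) (Fin \<beta>) MInf)"
  have c: "carrier (wreath_S2 real_add_group) = UNIV \<times> carrier (sym_group 2)"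
    by (simp add: wreath_S2_simps real_add_group_def)
  show ?thesis
  proof (rule trop.maximal_subgroup_iso[OF H wreath_S2_real_group, where f = f])
    fix g h assume gh: "g \<in> carrier (wreath_S2 real_add_group)" "h \<in> carrier (wreath_S2 real_add_group)"
    obtain \<alpha> \<beta> \<sigma> \<alpha>' \<beta>' \<tau> where g: "g = ((\<alpha>, \<beta>), \<sigma>)" and h: "h = ((\<alpha>', \<beta>'), \<tau>)"
      by (metis prod.exhaust)
    have "\<sigma> \<in> carrier (sym_group 2)" "\<tau> \<in> carrier (sym_group 2)" using gh g h c by auto
    from sym_group_2_comp_eq_id_iff[OF this]
    show "f (g \<otimes>\<^bsub>wreath_S2 real_add_group\<^esub> h) = f g ** f h"
      unfolding g h wreath_S2_real_mult f_def
      by (cases "\<sigma> = id"; cases "\<tau> = id") simp_all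
  next
    show "f \<one>\<^bsub>wreath_S2 real_add_group\<^esub> = interval_matrix MInf MInf"
      by (simp add: f_def wreath_S2_simps real_add_group_def interval_matrix_def)
    show "inj_on f (carrier (wreath_S2 real_add_group))"
      by (rule inj_onI) (auto simp: c f_def carrier_sym_group_2 split: if_splits)
    show "local_units trop_matrix_monoid (interval_matrix MInf MInf)
        \<subseteq> f ` carrier (wreath_S2 real_add_group)"
    proof
      fix X assume X: "X \<in> local_units trop_matrix_monoid (interval_matrix MInf MInf)"
      have lt: "ereal_of_tropical MInf < - ereal_of_tropical MInf" by simp
      show "X \<in> f ` carrier (wreath_S2 real_add_group)"
        using lt X
      proof (cases rule: local_units_interval_matrix)
        case (diagonal \<alpha> \<beta>)
        then have "X = f ((\<alpha>, \<beta>), id)" by (simp add: f_def)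
        then show ?thesis using one_in_sym_group_2 by (intro image_eqI) (auto simp: c)
      next
        case (antidiagonal \<alpha> \<beta>)
        then have "X = f ((\<alpha>, \<beta>), Transposition.transpose 1 2)"
          using transpose_neq_id by (auto simp: f_def)
        then show ?thesis using one_in_sym_group_2 by (intro image_eqI) (auto simp: c)
      qed
    qed
  qed simp
qed

section \<open>Maximal subgroups by isometry type\<close>

text \<open>Every interval with distinct endpoints is the projective column space of an interval matrix:
  its lower end is not \<open>\<infinity>\<close> and its upper end is not \<open>-\<infinity>\<close>, as the tropical entries require.\<close>

lemma ex_idempotent_isometric:
  assumes "closed_convex M"
  shows "\<exists>e. e ** e = e \<and> isometric (proj_column_space e) M"
proof -
  consider "M = {}" | z where "M = {z}" | x y where "x < y" "M = {x..y}"
    using assms unfolding closed_convex_def by blast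
  then show ?thesis
  proof cases
    case 1
    then show ?thesis
      using proj_column_space_zero isometric_refl by (intro exI[of _ "mat2 0 0 0 0"]) simp
  next
    case (2 z)
    have "proj_column_space (outer 1 0 1 0) = {proj_coords 1 0}"
      by (rule proj_column_space_outer) simp_all
    then show ?thesis
      using 2 isometric_singletons
      by (intro exI[of _ "outer 1 0 1 0"]) (simp add: outer_mult)
  next
    case (3 x y)
    have "\<exists>t. ereal_of_tropical t = z" if "z \<noteq> \<infinity>" for z
      using that by (cases z) (auto intro: exI[of _ "Fin r" for r] exI[of _ MInf])
    then obtain a b where ab: "ereal_of_tropical a = - y" "ereal_of_tropical b = x"
      using 3(1) by (metis ereal_infty_less(1) ereal_uminus_uminus less_ereal.simps(3) not_less_iff_gr_or_eq ereal_uminus_eq_reorder)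
    have lt: "ereal_of_tropical b < - ereal_of_tropical a" using 3 ab by simp
    have "interval_matrix a b ** interval_matrix a b = interval_matrix a b"
      using lt by (cases a; cases b) (auto simp: interval_matrix_def)
    moreover have "proj_column_space (interval_matrix a b) = M"
      using proj_column_space_interval_matrix[OF lt] 3 ab by simp
    ultimately show ?thesis using isometric_refl by metis
  qed
qed

text \<open>The parameters of such an idempotent are not determined by the interval, but its length and its
  number of infinite ends are, and only these enter the structure of the group.\<close>

lemma idempotent_isometric_Icc:
  assumes "e ** e = e" "isometric (proj_column_space e) {x..y}" "x < y"
  obtains a b where "ereal_of_tropical b < - ereal_of_tropical a" "e = interval_matrix a b"
    "y - x = - ereal_of_tropical a - ereal_of_tropical b"
    "x = -\<infinity> \<and> y = \<infinity> \<longleftrightarrow> a = MInf \<and> b = MInf"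
  using assms(1)
proof (cases rule: idempotent_cases)
  case zero
  then have "{x..y} = {}" using assms(2) proj_column_space_zero isometric_empty_iff(2) by metis
  then show ?thesis using assms(3) by auto
next
  case (rank_one u u' v v')
  then show ?thesis
    using assms(2,3) proj_column_space_outer isometric_singleton_Icc(1) by metis
next
  case (rank_two a b)
  have iso: "isometric {ereal_of_tropical b .. - ereal_of_tropical a} {x..y}"
    using assms(2) rank_two proj_column_space_interval_matrix by metis
  have "ereal_of_tropical b = -\<infinity> \<and> - ereal_of_tropical a = \<infinity> \<longleftrightarrow> a = MInf \<and> b = MInf"
    by (cases a; cases b) auto
  then show ?thesis
    using that[OF rank_two] isometric_Icc[OF iso rank_two(1) assms(3)] by metis
qed

lemma maximal_subgroup_isometric_empty:
  assumes H: "is_maximal_subgroup trop_matrix_monoid e H" and iso: "isometric (proj_column_space e) {}"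
  shows "sub_monoid_struct trop_matrix_monoid e H \<cong> singleton_group ()"
proof -
  have empty: "proj_column_space e = {}" using iso isometric_empty_iff(1) by metis
  from trop.maximal_subgroup_eq_local_units(2)[OF H] show ?thesis
  proof (cases rule: idempotent_cases)
    case zero
    then show ?thesis using maximal_subgroup_zero H by metis
  next
    case (rank_one u u' v v')
    then show ?thesis using empty proj_column_space_outer[OF rank_one(1,2)] by simp
  next
    case (rank_two a b)
    then show ?thesis using empty proj_column_space_interval_matrix[OF rank_two(1)] by simp
  qed
qed

lemma maximal_subgroup_isometric_point:
  assumes H: "is_maximal_subgroup trop_matrix_monoid e H" and iso: "isometric (proj_column_space e) {z}"
  shows "sub_monoid_struct trop_matrix_monoid e H \<cong> real_add_group"
proof -
  obtain w where w: "proj_column_space e = {w}"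
    using isometric_singleton_cases[OF isometric_sym[OF iso] refl] .
  from trop.maximal_subgroup_eq_local_units(2)[OF H] show ?thesis
  proof (cases rule: idempotent_cases)
    case zero
    then show ?thesis using w proj_column_space_zero by simp
  next
    case (rank_one u u' v v')
    then show ?thesis using maximal_subgroup_outer[OF rank_one(1-3)] H by simp
  next
    case (rank_two a b)
    then show ?thesis
      using w proj_column_space_interval_matrix[OF rank_two(1)] Icc_not_singleton[OF rank_two(1)] by simp
  qed
qed

lemma maximal_subgroup_isometric_half_line:
  assumes H: "is_maximal_subgroup trop_matrix_monoid e H"
    and iso: "isometric (proj_column_space e) {x..y}"
    and xy: "x < y" "(\<bar>x\<bar> \<noteq> \<infinity>) \<noteq> (\<bar>y\<bar> \<noteq> \<infinity>)"
  shows "sub_monoid_struct trop_matrix_monoid e H \<cong> real_add_group"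
proof -
  obtain a b where ab: "e = interval_matrix a b"
      "y - x = - ereal_of_tropical a - ereal_of_tropical b"
      "x = -\<infinity> \<and> y = \<infinity> \<longleftrightarrow> a = MInf \<and> b = MInf"
    using idempotent_isometric_Icc[OF trop.maximal_subgroup_eq_local_units(2)[OF H] iso xy(1)] .
  have "(a = MInf) \<noteq> (b = MInf)"
    using ab(2,3) xy by (cases x; cases y; cases a; cases b) auto
  then show ?thesis using maximal_subgroup_half_line H ab(1) by simp
qed

lemma maximal_subgroup_isometric_segment:
  assumes H: "is_maximal_subgroup trop_matrix_monoid e H"
    and iso: "isometric (proj_column_space e) {x..y}"
    and xy: "x < y" "\<bar>x\<bar> \<noteq> \<infinity>" "\<bar>y\<bar> \<noteq> \<infinity>"
  shows "sub_monoid_struct trop_matrix_monoid e H \<cong> real_add_group \<times>\<times> sym_group 2"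
proof -
  obtain a b where ab: "ereal_of_tropical b < - ereal_of_tropical a" "e = interval_matrix a b"
      "y - x = - ereal_of_tropical a - ereal_of_tropical b"
    using idempotent_isometric_Icc[OF trop.maximal_subgroup_eq_local_units(2)[OF H] iso xy(1)] .
  obtain s t where "a = Fin s" "b = Fin t"
    using ab(3) xy(2,3) by (cases x; cases y; cases a; cases b) auto
  then show ?thesis
    using maximal_subgroup_segment[of s t H] H ab(1,2) by simp
qed

lemma maximal_subgroup_isometric_line:
  assumes H: "is_maximal_subgroup trop_matrix_monoid e H"
    and iso: "isometric (proj_column_space e) UNIV"
  shows "sub_monoid_struct trop_matrix_monoid e H \<cong> wreath_S2 real_add_group"
proof -
  have U: "(UNIV :: ereal set) = {-\<infinity>..\<infinity>}" by auto
  obtain a b where "e = interval_matrix a b"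
      "(-\<infinity> :: ereal) = -\<infinity> \<and> (\<infinity> :: ereal) = \<infinity> \<longleftrightarrow> a = MInf \<and> b = MInf"
    by (rule idempotent_isometric_Icc[OF trop.maximal_subgroup_eq_local_units(2)[OF H] iso[unfolded U]])
      simp_all
  then show ?thesis using maximal_subgroup_line H by simp
qed

theorem theorem4p4:
  fixes M :: "ereal set"
  assumes "closed_convex M"
  shows "isometry_class M \<in> carrier trop_matrix_monoid // green_D trop_matrix_monoid
    \<and> (\<exists>e H. is_maximal_subgroup trop_matrix_monoid e H \<and> H \<subseteq> isometry_class M)
    \<and> (\<forall>e H. is_maximal_subgroup trop_matrix_monoid e H \<and> H \<subseteq> isometry_class M \<longrightarrow>
         (M = {} \<longrightarrow>
            sub_monoid_struct trop_matrix_monoid e H \<cong> singleton_group ())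
       \<and> ((\<exists>x. M = {x}) \<or> (\<exists>x y. x < y \<and> M = {x..y} \<and> (\<bar>x\<bar> \<noteq> \<infinity>) \<noteq> (\<bar>y\<bar> \<noteq> \<infinity>)) \<longrightarrow>
            sub_monoid_struct trop_matrix_monoid e H \<cong> real_add_group)
       \<and> ((\<exists>x y. x < y \<and> M = {x..y} \<and> \<bar>x\<bar> \<noteq> \<infinity> \<and> \<bar>y\<bar> \<noteq> \<infinity>) \<longrightarrow>
            sub_monoid_struct trop_matrix_monoid e H \<cong> real_add_group \<times>\<times> sym_group 2)
       \<and> (M = UNIV \<longrightarrow>
            sub_monoid_struct trop_matrix_monoid e H \<cong> wreath_S2 real_add_group))"
proof (intro conjI allI impI)
  obtain e where e: "e ** e = e" "isometric (proj_column_space e) M"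
    using ex_idempotent_isometric[OF assms] by blast
  have D: "isometry_class M = trop_D `` {e}"
    using e(2) by (intro isometry_class_eq_D_class) (simp add: mem_isometry_class_iff)
  show "isometry_class M \<in> carrier trop_matrix_monoid // green_D trop_matrix_monoid"
    unfolding D by (rule quotientI) (simp add: trop_matrix_monoid_def)
  have "is_maximal_subgroup trop_matrix_monoid e (local_units trop_matrix_monoid e)"
    using trop.local_units_maximal[of e] e(1) by simp
  moreover have "local_units trop_matrix_monoid e \<subseteq> isometry_class M"
    unfolding D using trop.local_units_green_R[of e] green_R_subset_D[of trop_matrix_monoid] by blast
  ultimately show "\<exists>e H. is_maximal_subgroup trop_matrix_monoid e H \<and> H \<subseteq> isometry_class M"
    by blast
next
  fix e H assume eH: "is_maximal_subgroup trop_matrix_monoid e H \<and> H \<subseteq> isometry_class M"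
  then have H: "is_maximal_subgroup trop_matrix_monoid e H" by (rule conjunct1)
  have "e \<in> isometry_class M"
    using trop.maximal_subgroup_eq_local_units(3)[OF H] eH by (metis subsetD)
  then have iso: "isometric (proj_column_space e) M" by (simp add: mem_isometry_class_iff)
  show "sub_monoid_struct trop_matrix_monoid e H \<cong> singleton_group ()" if "M = {}"
    using maximal_subgroup_isometric_empty[OF H] iso that by simp
  show "sub_monoid_struct trop_matrix_monoid e H \<cong> real_add_group"
    if "(\<exists>x. M = {x}) \<or> (\<exists>x y. x < y \<and> M = {x..y} \<and> (\<bar>x\<bar> \<noteq> \<infinity>) \<noteq> (\<bar>y\<bar> \<noteq> \<infinity>))"
    using that
  proof (elim disjE exE conjE)
    show ?thesis if "M = {z}" for z
      using maximal_subgroup_isometric_point[OF H] iso that by simp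
    show ?thesis if "x < y" "M = {x..y}" "(\<bar>x\<bar> \<noteq> \<infinity>) \<noteq> (\<bar>y\<bar> \<noteq> \<infinity>)" for x y
      using maximal_subgroup_isometric_half_line[OF H _ that(1,3)] iso that(2) by simp
  qed
  show "sub_monoid_struct trop_matrix_monoid e H \<cong> real_add_group \<times>\<times> sym_group 2"
    if "\<exists>x y. x < y \<and> M = {x..y} \<and> \<bar>x\<bar> \<noteq> \<infinity> \<and> \<bar>y\<bar> \<noteq> \<infinity>"
    using that
  proof (elim exE conjE)
    show ?thesis if "x < y" "M = {x..y}" "\<bar>x\<bar> \<noteq> \<infinity>" "\<bar>y\<bar> \<noteq> \<infinity>" for x y
      using maximal_subgroup_isometric_segment[OF H _ that(1,3,4)] iso that(2) by simp
  qed
  show "sub_monoid_struct trop_matrix_monoid e H \<cong> wreath_S2 real_add_group" if "M = UNIV"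
    using maximal_subgroup_isometric_line[OF H] iso that by simp
qed

end
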